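(* Let $P:\mathcal{A}\to\mathcal{X}$ be an ordered functor between ordered categories. Assume that $\mathcal{X}$ has all tensor products $W\otimes PD$ (with $W$ a partially ordered set and $D$ an object of $\mathcal{A}$), as well as conical generalized pushouts of arbitrary families of tensor comparison morphisms. Then $P$ is order-solid if and only if $\mathcal{A}$ is tensored and $P$ admits order-universal $P$-extensions for all $\mathsf{1}$-weighted cocones of discrete shape. Moreover, the assumption on $\mathcal{X}$ is satisfied in particular when $\mathcal{A}$ is tensored and $P$ preserves tensor products.
   Context: $\mathcal{P}os$ is the category of partially ordered sets and monotone maps. An ordered category is a category whose hom-sets carry a partial order preserved by composition from either side; an ordered functor is a functor whose hom-maps are monotone. $\mathcal{P}os$ is ordered by the pointwise order of maps. $\mathcal{D}^{\mathrm{op}}$ reverses arrows but keeps their order. Weighted cocones: an ordered diagram of shape $\mathcal{D}$ in $\mathcal{A}$ is an ordered functor $D:\mathcal{D}\to\mathcal{A}$, where $\mathcal{D}$ is an ordered category of unrestricted size. A weight is an ordered functor $W:\mathcal{D}^{\mathrm{op}}\to\mathcal{P}os$. A $W$-weighted cocone $\alpha:D\to A$ is a family of morphisms $\alpha_i^u:Di\to A$ ($i\in\mathrm{ob}\,\mathcal{D}$, $u\in Wi$) with $\alpha_i^u\le\alpha_i^v$ whenever $u\le v$ in $Wi$, and $\alpha_j^v\cdot Dd=\alpha_i^{Wd(v)}$ for all $d:i\to j$ in $\mathcal{D}$, $v\in Wj$. Equalities and inequalities involving cocones are meant componentwise. A $\mathsf{1}$-weighted cocone is one whose weight is constantly the one-element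 ordered set, i.e. an ordinary cocone; a $\mathsf{1}$-weighted cocone of discrete shape over $PD$ is just a (possibly empty, possibly class-indexed) family of morphisms $PD_i\to X$. Order-universal $P$-extension of a $W$-weighted cocone $\xi:PD\to X$ in $\mathcal{X}$ (with $D:\mathcal{D}\to\mathcal{A}$): a triple $(\alpha,A,q)$ with a $W$-weighted cocone $\alpha:D\to A$ in $\mathcal{A}$ and $q:X\to PA$ such that: 1. $q\cdot\xi=P\alpha$; 2. for every $W$-weighted cocone $\beta:D\to B$ in $\mathcal{A}$ and $f:X\to PB$ with $f\cdot\xi=P\beta$ there is a (unique) $t:A\to B$ with $t\cdot\alpha=\beta$ and $Pt\cdot q=f$; 3. for all $r,s:A\to B$ in $\mathcal{A}$, if $Pr\cdot q\le Ps\cdot q$ and $r\cdot\alpha\le s\cdot\alpha$, then $r\le s$. $P$ is order-solid if every weighted cocone $\xi:PD\to X$, for every ordered diagram $D$ in $\mathcal{A}$ of any shape and any weight, has an order-universal $P$-extension. A $W$-weighted colimit of $D$ is a $W$-weighted cocone $\alpha:D\to A$ such that every $W$-weighted cocone $\beta:D\to B$ is $\beta=t\cdot\alpha$ for a unique $t:A\to B$, and $\alpha$ is order-epic: $r\cdot\alpha\le s\cdot\alpha$ implies $r\le s$. A conical colimit is a $\mathsf{1}$-weighted colimit, i.e. an ordinary colimit whose cocone is order-epic; in particular one speaks of conical pushouts and conical wide pushouts. Tensor products: for a partially ordered set $W$ and an object $D$, the tensor product $W\otimes D$ is the weighted colimit over the one-object (terminal) shape, i.e. it comes with morphisms $\lambda^u:D\to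 W\otimes D$ ($u\in W$), monotone in $u$, inducing order-isomorphisms $\mathcal{A}(W\otimes D,B)\cong\mathcal{P}os(W,\mathcal{A}(D,B))$ naturally in $B$. $\mathcal{A}$ is tensored if all $W\otimes D$ exist in $\mathcal{A}$. $P$ preserves tensor products if, for every tensor product $(\lambda^u:D\to W\otimes D)_{u\in W}$ in $\mathcal{A}$, $(P\lambda^u)_{u\in W}$ is a tensor product of $W$ and $PD$ in $\mathcal{X}$. Whenever $W\otimes A$ exists in $\mathcal{A}$ with cocone $(\lambda^u)_u$ and $W\otimes PA$ exists in $\mathcal{X}$ with cocone $(\kappa^u)_u$, the canonical morphism $c:W\otimes PA\to P(W\otimes A)$ with $c\cdot\kappa^u=P\lambda^u$ for all $u\in W$ is called a tensor comparison morphism. $\mathcal{X}$ has conical generalized pushouts of (arbitrary families of) tensor comparison morphisms if the conical pushout of a tensor comparison morphism along any morphism exists in $\mathcal{X}$, and the conical wide pushout of any (possibly large) family of such pushouts (with common domain) exists as well. *)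

theory Defs
  imports Main "HOL-Library.FuncSet" "HOL-Library.Equipollence"
begin

text \<open>
  Size conventions. A type \<open>'u\<close> plays the role of the universe: a class is an arbitrary
  set over \<open>'u\<close>, and a (small) set is a class that is strictly smaller than the universe
  (limitation of size). Ordered categories over \<open>'u\<close>, in particular shapes of diagrams, are
  therefore of unrestricted size, and weights take values in small partially ordered sets only.
\<close>

definition small :: "'u set \<Rightarrow> bool"
  where "small S \<longleftrightarrow> S \<prec> (UNIV :: 'u set)"


section \<open>Ordered categories and ordered functors\<close>

record ('o, 'm) ocat =
  Ob :: "'o set"
  Arr :: "'m set"
  Src :: "'m \<Rightarrow> 'o"
  Tgt :: "'m \<Rightarrow> 'o"
  Idt :: "'o \<Rightarrow> 'm"
  Comp :: "'m \<Rightarrow> 'm \<Rightarrow> 'm"  (infixl "\<cdot>\<index>" 70)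
  Leq :: "'m \<Rightarrow> 'm \<Rightarrow> bool"  (infix "\<sqsubseteq>\<index>" 50)

definition Hom :: "('o, 'm, 'z) ocat_scheme \<Rightarrow> 'o \<Rightarrow> 'o \<Rightarrow> 'm set"
  where "Hom C a b = {f \<in> Arr C. Src C f = a \<and> Tgt C f = b}"

locale ordered_category =
  fixes C :: "('o, 'm) ocat" (structure)
  assumes src_in_Ob: "f \<in> Arr C \<Longrightarrow> Src C f \<in> Ob C"
    and tgt_in_Ob: "f \<in> Arr C \<Longrightarrow> Tgt C f \<in> Ob C"
    and idt_in_Hom: "a \<in> Ob C \<Longrightarrow> Idt C a \<in> Hom C a a"
    and comp_in_Hom: "\<lbrakk>f \<in> Hom C a b; g \<in> Hom C b c\<rbrakk> \<Longrightarrow> g \<cdot> f \<in> Hom C a c"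
    and comp_idt_right: "f \<in> Hom C a b \<Longrightarrow> f \<cdot> Idt C a = f"
    and comp_idt_left: "f \<in> Hom C a b \<Longrightarrow> Idt C b \<cdot> f = f"
    and comp_assoc: "\<lbrakk>f \<in> Hom C a b; g \<in> Hom C b c; h \<in> Hom C c d\<rbrakk>
          \<Longrightarrow> (h \<cdot> g) \<cdot> f = h \<cdot> (g \<cdot> f)"
    and hom_order: "partial_order_on (Hom C a b)
          {(f, g). f \<in> Hom C a b \<and> g \<in> Hom C a b \<and> f \<sqsubseteq> g}"
    and comp_mono_left: "\<lbrakk>f \<in> Hom C a b; f' \<in> Hom C a b; f \<sqsubseteq> f'; g \<in> Hom C b c\<rbrakk>
          \<Longrightarrow> g \<cdot> f \<sqsubseteq> g \<cdot> f'"
    and comp_mono_right: "\<lbrakk>f \<in> Hom C a b; g \<in> Hom C b c; g' \<in> Hom C b c; g \<sqsubseteq> g'\<rbrakk>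
          \<Longrightarrow> g \<cdot> f \<sqsubseteq> g' \<cdot> f"

record ('o, 'm, 'p, 'n) ofunctor =
  FOb :: "'o \<Rightarrow> 'p"
  FArr :: "'m \<Rightarrow> 'n"

locale ordered_functor =
  source: ordered_category C + target: ordered_category D
  for C :: "('o, 'm) ocat" and D :: "('p, 'n) ocat" +
  fixes F :: "('o, 'm, 'p, 'n) ofunctor"
  assumes FOb_in_Ob: "a \<in> Ob C \<Longrightarrow> FOb F a \<in> Ob D"
    and FArr_in_Hom: "f \<in> Hom C a b \<Longrightarrow> FArr F f \<in> Hom D (FOb F a) (FOb F b)"
    and FArr_idt: "a \<in> Ob C \<Longrightarrow> FArr F (Idt C a) = Idt D (FOb F a)"
    and FArr_comp: "\<lbrakk>f \<in> Hom C a b; g \<in> Hom C b c\<rbrakk>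
          \<Longrightarrow> FArr F (g \<cdot>\<^bsub>C\<^esub> f) = FArr F g \<cdot>\<^bsub>D\<^esub> FArr F f"
    and FArr_mono: "\<lbrakk>f \<in> Hom C a b; g \<in> Hom C a b; f \<sqsubseteq>\<^bsub>C\<^esub> g\<rbrakk>
          \<Longrightarrow> FArr F f \<sqsubseteq>\<^bsub>D\<^esub> FArr F g"

definition op_cat :: "('o, 'm) ocat \<Rightarrow> ('o, 'm) ocat"
  where "op_cat C = C\<lparr>Src := Tgt C, Tgt := Src C, Comp := (\<lambda>g f. f \<cdot>\<^bsub>C\<^esub> g)\<rparr>"

definition comp_functor ::
    "('p, 'n, 'q, 'k) ofunctor \<Rightarrow> ('o, 'm, 'p, 'n) ofunctor \<Rightarrow> ('o, 'm, 'q, 'k) ofunctor"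
  where "comp_functor G F = \<lparr>FOb = FOb G \<circ> FOb F, FArr = FArr G \<circ> FArr F\<rparr>"

definition const_functor :: "('p, 'n) ocat \<Rightarrow> 'p \<Rightarrow> ('o, 'm, 'p, 'n) ofunctor"
  where "const_functor D b = \<lparr>FOb = (\<lambda>_. b), FArr = (\<lambda>_. Idt D b)\<rparr>"


section \<open>The ordered category of partially ordered sets\<close>

text \<open>
  A partially ordered set is given by its order relation \<open>r\<close>; by reflexivity its carrier is
  \<open>Field r\<close>. A monotone map is a triple (domain, function, codomain), the function being
  extensional so that equality of arrows is equality of maps.
\<close>

type_synonym 'u pmap = "'u rel \<times> ('u \<Rightarrow> 'u) \<times> 'u rel"

definition papp :: "'u pmap \<Rightarrow> 'u \<Rightarrow> 'u"
  where "papp m = fst (snd m)"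

definition Pos :: "('u rel, 'u pmap) ocat"
  where "Pos = \<lparr>
    Ob = {r. Partial_order r \<and> small (Field r)},
    Arr = {(r, f, s). Partial_order r \<and> small (Field r) \<and> Partial_order s \<and> small (Field s) \<and>
             f \<in> Field r \<rightarrow>\<^sub>E Field s \<and> (\<forall>(u, v) \<in> r. (f u, f v) \<in> s)},
    Src = (\<lambda>(r, f, s). r),
    Tgt = (\<lambda>(r, f, s). s),
    Idt = (\<lambda>r. (r, restrict id (Field r), r)),
    Comp = (\<lambda>(_, g, t) (r, f, _). (r, compose (Field r) g f, t)),
    Leq = (\<lambda>(r, f, s) (r', g, s'). \<forall>u \<in> Field r. (f u, g u) \<in> s)\<rparr>"

lemma Hom_Pos_iff:
  "m \<in> Hom Pos r s \<longleftrightarrow> r \<in> Ob Pos \<and> s \<in> Ob Pos \<and>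
     (\<exists>f. m = (r, f, s) \<and> f \<in> Field r \<rightarrow>\<^sub>E Field s \<and> (\<forall>u v. (u, v) \<in> r \<longrightarrow> (f u, f v) \<in> s))"
  by (auto simp: Hom_def Pos_def)

lemma Ob_Pos_iff: "r \<in> Ob Pos \<longleftrightarrow> Partial_order r \<and> small (Field r)"
  by (simp add: Pos_def)

lemma Pos_simps:
  "Idt Pos r = (r, restrict id (Field r), r)"
  "(s', g, t) \<cdot>\<^bsub>Pos\<^esub> (r, f, s) = (r, compose (Field r) g f, t)"
  "(r, f, s) \<sqsubseteq>\<^bsub>Pos\<^esub> (r', g, s') \<longleftrightarrow> (\<forall>u \<in> Field r. (f u, g u) \<in> s)"
  by (simp_all add: Pos_def)

lemma ordered_category_Pos: "ordered_category Pos"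
proof
  fix f :: "'u pmap" assume "f \<in> Arr Pos"
  then show "Src Pos f \<in> Ob Pos" "Tgt Pos f \<in> Ob Pos"
    by (auto simp: Pos_def)
next
  fix a :: "'u rel" assume "a \<in> Ob Pos"
  then show "Idt Pos a \<in> Hom Pos a a"
    by (auto simp: Hom_Pos_iff Pos_simps FieldI1 FieldI2)
next
  fix f g :: "'u pmap" and a b c assume "f \<in> Hom Pos a b" "g \<in> Hom Pos b c"
  then show "g \<cdot>\<^bsub>Pos\<^esub> f \<in> Hom Pos a c"
    by (auto simp: Hom_Pos_iff Pos_simps compose_def FieldI1 FieldI2 PiE_iff)
next
  fix f :: "'u pmap" and a b assume "f \<in> Hom Pos a b"
  then show "f \<cdot>\<^bsub>Pos\<^esub> Idt Pos a = f" "Idt Pos b \<cdot>\<^bsub>Pos\<^esub> f = f"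
    by (auto simp: Hom_Pos_iff Pos_simps compose_def fun_eq_iff restrict_def PiE_iff extensional_def)
next
  fix f g h :: "'u pmap" and a b c d
  assume "f \<in> Hom Pos a b" "g \<in> Hom Pos b c" "h \<in> Hom Pos c d"
  then show "h \<cdot>\<^bsub>Pos\<^esub> g \<cdot>\<^bsub>Pos\<^esub> f = h \<cdot>\<^bsub>Pos\<^esub> (g \<cdot>\<^bsub>Pos\<^esub> f)"
    by (auto simp: Hom_Pos_iff Pos_simps compose_def fun_eq_iff restrict_def PiE_iff)
next
  fix a b :: "'u rel"
  let ?R = "{(f, g). f \<in> Hom Pos a b \<and> g \<in> Hom Pos a b \<and> f \<sqsubseteq>\<^bsub>Pos\<^esub> g}"
  show "partial_order_on (Hom Pos a b) ?R"
  proof (cases "a \<in> Ob Pos \<and> b \<in> Ob Pos")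
    case True
    then have b: "refl_on (Field b) b" "trans b" "antisym b"
      by (auto simp: Ob_Pos_iff partial_order_on_def preorder_on_def)
    have "refl_on (Hom Pos a b) ?R"
      using b(1) by (auto simp: refl_on_def Hom_Pos_iff Pos_simps PiE_iff)
    moreover have "trans ?R"
      by (rule transI) (auto simp: Hom_Pos_iff Pos_simps, meson transD[OF b(2)])
    moreover have "antisym ?R"
      by (rule antisymI)
        (clarsimp simp: Hom_Pos_iff Pos_simps, rule PiE_ext, assumption+, blast intro: antisymD[OF b(3)])
    ultimately show ?thesis
      by (auto simp: partial_order_on_def preorder_on_def)
  next
    case False
    then have "Hom Pos a b = {}" by (auto simp: Hom_Pos_iff)
    then show ?thesis by simp
  qed
next
  fix f f' g g' :: "'u pmap" and a b c
  show "g \<cdot>\<^bsub>Pos\<^esub> f \<sqsubseteq>\<^bsub>Pos\<^esub> g \<cdot>\<^bsub>Pos\<^esub> f'"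
    if "f \<in> Hom Pos a b" "f' \<in> Hom Pos a b" "f \<sqsubseteq>\<^bsub>Pos\<^esub> f'" "g \<in> Hom Pos b c"
    using that by (auto simp: Hom_Pos_iff Pos_simps compose_def)
  show "g \<cdot>\<^bsub>Pos\<^esub> f \<sqsubseteq>\<^bsub>Pos\<^esub> g' \<cdot>\<^bsub>Pos\<^esub> f"
    if "f \<in> Hom Pos a b" "g \<in> Hom Pos b c" "g' \<in> Hom Pos b c" "g \<sqsubseteq>\<^bsub>Pos\<^esub> g'"
    using that by (auto simp: Hom_Pos_iff Pos_simps compose_def PiE_iff)
qed

text \<open>The one-element ordered set; which element is taken is immaterial.\<close>

definition one_poset :: "'u rel"
  where "one_poset = {(undefined, undefined)}"


section \<open>Weighted cocones and weighted colimits\<close>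

abbreviation weight :: "('i, 'j) ocat \<Rightarrow> ('i, 'j, 'u rel, 'u pmap) ofunctor \<Rightarrow> bool"
  where "weight S W \<equiv> ordered_functor (op_cat S) Pos W"

definition one_weight :: "('i, 'j, 'u rel, 'u pmap) ofunctor"
  where "one_weight = const_functor Pos one_poset"

definition weighted_cocone ::
    "('o, 'm) ocat \<Rightarrow> ('i, 'j) ocat \<Rightarrow> ('i, 'j, 'u rel, 'u pmap) ofunctor
      \<Rightarrow> ('i, 'j, 'o, 'm) ofunctor \<Rightarrow> ('i \<Rightarrow> 'u \<Rightarrow> 'm) \<Rightarrow> 'o \<Rightarrow> bool"
  where "weighted_cocone C S W D \<alpha> A \<longleftrightarrow>
    A \<in> Ob C \<and>
    (\<forall>i \<in> Ob S. \<forall>u \<in> Field (FOb W i). \<alpha> i u \<in> Hom C (FOb D i) A) \<and>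
    (\<forall>i \<in> Ob S. \<forall>(u, v) \<in> FOb W i. \<alpha> i u \<sqsubseteq>\<^bsub>C\<^esub> \<alpha> i v) \<and>
    (\<forall>i \<in> Ob S. \<forall>j \<in> Ob S. \<forall>d \<in> Hom S i j. \<forall>v \<in> Field (FOb W j).
       \<alpha> j v \<cdot>\<^bsub>C\<^esub> FArr D d = \<alpha> i (papp (FArr W d) v))"

definition weighted_colimit ::
    "('o, 'm) ocat \<Rightarrow> ('i, 'j) ocat \<Rightarrow> ('i, 'j, 'u rel, 'u pmap) ofunctor
      \<Rightarrow> ('i, 'j, 'o, 'm) ofunctor \<Rightarrow> ('i \<Rightarrow> 'u \<Rightarrow> 'm) \<Rightarrow> 'o \<Rightarrow> bool"
  where "weighted_colimit C S W D \<alpha> A \<longleftrightarrow>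
    weighted_cocone C S W D \<alpha> A \<and>
    (\<forall>B \<beta>. weighted_cocone C S W D \<beta> B \<longrightarrow>
       (\<exists>!t. t \<in> Hom C A B \<and>
             (\<forall>i \<in> Ob S. \<forall>u \<in> Field (FOb W i). t \<cdot>\<^bsub>C\<^esub> \<alpha> i u = \<beta> i u))) \<and>
    (\<forall>B. \<forall>r \<in> Hom C A B. \<forall>s \<in> Hom C A B.
       (\<forall>i \<in> Ob S. \<forall>u \<in> Field (FOb W i). r \<cdot>\<^bsub>C\<^esub> \<alpha> i u \<sqsubseteq>\<^bsub>C\<^esub> s \<cdot>\<^bsub>C\<^esub> \<alpha> i u)
       \<longrightarrow> r \<sqsubseteq>\<^bsub>C\<^esub> s)"


section \<open>Order-universal extensions and order-solid functors\<close>

definition order_universal_extension ::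
    "('o, 'm) ocat \<Rightarrow> ('p, 'n) ocat \<Rightarrow> ('o, 'm, 'p, 'n) ofunctor
      \<Rightarrow> ('i, 'j) ocat \<Rightarrow> ('i, 'j, 'u rel, 'u pmap) ofunctor \<Rightarrow> ('i, 'j, 'o, 'm) ofunctor
      \<Rightarrow> ('i \<Rightarrow> 'u \<Rightarrow> 'n) \<Rightarrow> 'p \<Rightarrow> ('i \<Rightarrow> 'u \<Rightarrow> 'm) \<Rightarrow> 'o \<Rightarrow> 'n \<Rightarrow> bool"
  where "order_universal_extension \<A> \<X> P S W D \<xi> X \<alpha> A q \<longleftrightarrow>
    weighted_cocone \<A> S W D \<alpha> A \<and> q \<in> Hom \<X> X (FOb P A) \<and>
    (\<forall>i \<in> Ob S. \<forall>u \<in> Field (FOb W i). q \<cdot>\<^bsub>\<X>\<^esub> \<xi> i u = FArr P (\<alpha> i u)) \<and>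
    (\<forall>B \<beta> f. weighted_cocone \<A> S W D \<beta> B \<and> f \<in> Hom \<X> X (FOb P B) \<and>
       (\<forall>i \<in> Ob S. \<forall>u \<in> Field (FOb W i). f \<cdot>\<^bsub>\<X>\<^esub> \<xi> i u = FArr P (\<beta> i u)) \<longrightarrow>
       (\<exists>!t. t \<in> Hom \<A> A B \<and>
             (\<forall>i \<in> Ob S. \<forall>u \<in> Field (FOb W i). t \<cdot>\<^bsub>\<A>\<^esub> \<alpha> i u = \<beta> i u) \<and>
             FArr P t \<cdot>\<^bsub>\<X>\<^esub> q = f)) \<and>
    (\<forall>B. \<forall>r \<in> Hom \<A> A B. \<forall>s \<in> Hom \<A> A B.
       FArr P r \<cdot>\<^bsub>\<X>\<^esub> q \<sqsubseteq>\<^bsub>\<X>\<^esub> FArr P s \<cdot>\<^bsub>\<X>\<^esub> q \<and>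
       (\<forall>i \<in> Ob S. \<forall>u \<in> Field (FOb W i). r \<cdot>\<^bsub>\<A>\<^esub> \<alpha> i u \<sqsubseteq>\<^bsub>\<A>\<^esub> s \<cdot>\<^bsub>\<A>\<^esub> \<alpha> i u)
       \<longrightarrow> r \<sqsubseteq>\<^bsub>\<A>\<^esub> s)"

text \<open>
  From here on everything lives over one universe \<open>'u\<close>, so that shapes range over all ordered
  categories of the same (class) size as \<open>\<A>\<close> and \<open>\<X>\<close>.
\<close>

definition order_solid ::
    "('u, 'u) ocat \<Rightarrow> ('u, 'u) ocat \<Rightarrow> ('u, 'u, 'u, 'u) ofunctor \<Rightarrow> bool"
  where "order_solid \<A> \<X> P \<longleftrightarrow>
    (\<forall>(S :: ('u, 'u) ocat) (W :: ('u, 'u, 'u rel, 'u pmap) ofunctor) D \<xi> X.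
       ordered_functor S \<A> D \<and> weight S W \<and>
       weighted_cocone \<X> S W (comp_functor P D) \<xi> X \<longrightarrow>
       (\<exists>\<alpha> A q. order_universal_extension \<A> \<X> P S W D \<xi> X \<alpha> A q))"

definition discrete_shape :: "('i, 'j) ocat \<Rightarrow> bool"
  where "discrete_shape S \<longleftrightarrow>
    ordered_category S \<and> (\<forall>d \<in> Arr S. d = Idt S (Src S d))"

definition admits_discrete_extensions ::
    "('u, 'u) ocat \<Rightarrow> ('u, 'u) ocat \<Rightarrow> ('u, 'u, 'u, 'u) ofunctor \<Rightarrow> bool"
  where "admits_discrete_extensions \<A> \<X> P \<longleftrightarrow>
    (\<forall>(S :: ('u, 'u) ocat) D (\<xi> :: 'u \<Rightarrow> 'u \<Rightarrow> 'u) X.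
       discrete_shape S \<and> ordered_functor S \<A> D \<and>
       weighted_cocone \<X> S one_weight (comp_functor P D) \<xi> X \<longrightarrow>
       (\<exists>\<alpha> A q. order_universal_extension \<A> \<X> P S one_weight D \<xi> X \<alpha> A q))"


section \<open>Tensor products\<close>

definition terminal_shape :: "(unit, unit) ocat"
  where "terminal_shape = \<lparr>Ob = UNIV, Arr = UNIV, Src = (\<lambda>_. ()), Tgt = (\<lambda>_. ()),
    Idt = (\<lambda>_. ()), Comp = (\<lambda>_ _. ()), Leq = (\<lambda>_ _. True)\<rparr>"

lemma ordered_category_terminal_shape: "ordered_category terminal_shape"
  by standard
    (auto simp: terminal_shape_def Hom_def partial_order_on_def preorder_on_def refl_on_def
      trans_def antisym_def)

definition is_tensor ::
    "('o, 'm) ocat \<Rightarrow> 'u rel \<Rightarrow> 'o \<Rightarrow> ('u \<Rightarrow> 'm) \<Rightarrow> 'o \<Rightarrow> bool"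
  where "is_tensor C W D l T \<longleftrightarrow>
    W \<in> Ob Pos \<and> D \<in> Ob C \<and>
    weighted_colimit C terminal_shape (const_functor Pos W) (const_functor C D) (\<lambda>_. l) T"

definition tensored :: "('u, 'u) ocat \<Rightarrow> bool"
  where "tensored \<A> \<longleftrightarrow>
    (\<forall>(W :: 'u rel) \<in> Ob Pos. \<forall>D \<in> Ob \<A>. \<exists>l T. is_tensor \<A> W D l T)"

definition has_tensors_of_image ::
    "('u, 'u) ocat \<Rightarrow> ('u, 'u) ocat \<Rightarrow> ('u, 'u, 'u, 'u) ofunctor \<Rightarrow> bool"
  where "has_tensors_of_image \<A> \<X> P \<longleftrightarrow>
    (\<forall>(W :: 'u rel) \<in> Ob Pos. \<forall>D \<in> Ob \<A>. \<exists>k T. is_tensor \<X> W (FOb P D) k T)"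

definition preserves_tensors ::
    "('u, 'u) ocat \<Rightarrow> ('u, 'u) ocat \<Rightarrow> ('u, 'u, 'u, 'u) ofunctor \<Rightarrow> bool"
  where "preserves_tensors \<A> \<X> P \<longleftrightarrow>
    (\<forall>(W :: 'u rel) D l T. is_tensor \<A> W D l T \<longrightarrow>
       is_tensor \<X> W (FOb P D) (\<lambda>u. FArr P (l u)) (FOb P T))"

definition tensor_comparison ::
    "('u, 'u) ocat \<Rightarrow> ('u, 'u) ocat \<Rightarrow> ('u, 'u, 'u, 'u) ofunctor \<Rightarrow> 'u \<Rightarrow> bool"
  where "tensor_comparison \<A> \<X> P c \<longleftrightarrow>
    (\<exists>(W :: 'u rel) A l T k K. is_tensor \<A> W A l T \<and> is_tensor \<X> W (FOb P A) k K \<and>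
       c \<in> Hom \<X> K (FOb P T) \<and> (\<forall>u \<in> Field W. c \<cdot>\<^bsub>\<X>\<^esub> k u = FArr P (l u)))"


section \<open>Conical pushouts and wide pushouts\<close>

definition conical_colimit ::
    "('u, 'u) ocat \<Rightarrow> ('i, 'j) ocat \<Rightarrow> ('i, 'j, 'u, 'u) ofunctor \<Rightarrow> ('i \<Rightarrow> 'u) \<Rightarrow> 'u \<Rightarrow> bool"
  where "conical_colimit C S D \<alpha> A \<longleftrightarrow>
    weighted_colimit C S (one_weight :: ('i, 'j, 'u rel, 'u pmap) ofunctor) D (\<lambda>i _. \<alpha> i) A"

text \<open>
  The wide span shape: a centre \<open>None\<close> with one arrow \<open>(None, Some i)\<close> to each \<open>Some i\<close>.
\<close>

definition span_shape :: "'i set \<Rightarrow> ('i option, 'i option \<times> 'i option) ocat"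
  where "span_shape I = \<lparr>
    Ob = insert None (Some ` I),
    Arr = {(a, b). a \<in> insert None (Some ` I) \<and> b \<in> insert None (Some ` I) \<and>
             (a = b \<or> a = None)},
    Src = fst, Tgt = snd,
    Idt = (\<lambda>a. (a, a)),
    Comp = (\<lambda>g f. (fst f, snd g)),
    Leq = (=)\<rparr>"

definition span_diagram ::
    "('o, 'm) ocat \<Rightarrow> 'o \<Rightarrow> ('i \<Rightarrow> 'm) \<Rightarrow> ('i option, 'i option \<times> 'i option, 'o, 'm) ofunctor"
  where "span_diagram C Y e =
    (let F = case_option Y (\<lambda>i. Tgt C (e i)) in
     \<lparr>FOb = F, FArr = (\<lambda>(a, b). if a = b then Idt C (F a) else e (the b))\<rparr>)"

lemma ordered_functor_span_diagram:
  assumes "ordered_category C" "Y \<in> Ob C" "\<And>i. i \<in> I \<Longrightarrow> e i \<in> Arr C \<and> Src C (e i) = Y"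
  shows "ordered_functor (span_shape I) C (span_diagram C Y e)"
proof -
  interpret ordered_category C by fact
  have e: "e i \<in> Hom C Y (Tgt C (e i))" "Tgt C (e i) \<in> Ob C" if "i \<in> I" for i
    using assms(3)[OF that] by (auto simp: Hom_def tgt_in_Ob)
  have refl: "f \<sqsubseteq>\<^bsub>C\<^esub> f" if "f \<in> Arr C" for f
    using hom_order[of "Src C f" "Tgt C f"] that
    by (auto simp: partial_order_on_def preorder_on_def refl_on_def Hom_def)
  have units: "Idt C a \<cdot>\<^bsub>C\<^esub> Idt C a = Idt C a" "i \<in> I \<Longrightarrow> e i \<cdot>\<^bsub>C\<^esub> Idt C Y = e i"
    "i \<in> I \<Longrightarrow> Idt C (Tgt C (e i)) \<cdot>\<^bsub>C\<^esub> e i = e i" if "a \<in> Ob C" for a i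
    using that e comp_idt_right comp_idt_left idt_in_Hom by blast+
  show ?thesis
  proof
    fix f g :: "'c option \<times> 'c option" and a b
    assume "f \<in> Hom (span_shape I) a b" "g \<in> Hom (span_shape I) a b" "f \<sqsubseteq>\<^bsub>span_shape I\<^esub> g"
    then show "FArr (span_diagram C Y e) f \<sqsubseteq>\<^bsub>C\<^esub> FArr (span_diagram C Y e) g"
      using e assms(2) idt_in_Hom
      by (auto simp: span_shape_def span_diagram_def Hom_def Let_def split: option.splits
          intro!: refl)
  next
    fix a b
    show "partial_order_on (Hom (span_shape I) a b)
      {(f, g). f \<in> Hom (span_shape I) a b \<and> g \<in> Hom (span_shape I) a b \<and> f \<sqsubseteq>\<^bsub>span_shape I\<^esub> g}"
      by (auto simp: span_shape_def partial_order_on_def preorder_on_def refl_on_def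
          trans_def antisym_def)
  qed (use e assms(2) idt_in_Hom units in
      \<open>auto simp: span_shape_def span_diagram_def Hom_def Let_def split: option.splits\<close>)
qed

definition conical_wide_pushout ::
    "('u, 'u) ocat \<Rightarrow> 'i set \<Rightarrow> 'u \<Rightarrow> ('i \<Rightarrow> 'u) \<Rightarrow> ('i option \<Rightarrow> 'u) \<Rightarrow> 'u \<Rightarrow> bool"
  where "conical_wide_pushout C I Y e \<alpha> Q \<longleftrightarrow>
    conical_colimit C (span_shape I) (span_diagram C Y e) \<alpha> Q"

text \<open>
  The pushout square \<open>g' \<cdot> f = f' \<cdot> g\<close>, in which \<open>f'\<close> is the pushout of \<open>f\<close> along \<open>g\<close>.
\<close>

definition conical_pushout ::
    "('u, 'u) ocat \<Rightarrow> 'u \<Rightarrow> 'u \<Rightarrow> 'u \<Rightarrow> 'u \<Rightarrow> 'u \<Rightarrow> bool"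
  where "conical_pushout C f g f' g' Q \<longleftrightarrow>
    f \<in> Arr C \<and> g \<in> Arr C \<and> Src C f = Src C g \<and>
    conical_wide_pushout C (UNIV :: bool set) (Src C f) (case_bool f g)
      (case_option (g' \<cdot>\<^bsub>C\<^esub> f) (case_bool g' f')) Q"

definition has_conical_generalized_pushouts_of_comparisons ::
    "('u, 'u) ocat \<Rightarrow> ('u, 'u) ocat \<Rightarrow> ('u, 'u, 'u, 'u) ofunctor \<Rightarrow> bool"
  where "has_conical_generalized_pushouts_of_comparisons \<A> \<X> P \<longleftrightarrow>
    (\<forall>c g. tensor_comparison \<A> \<X> P c \<and> g \<in> Arr \<X> \<and> Src \<X> g = Src \<X> c \<longrightarrow>
       (\<exists>c' g' Q. conical_pushout \<X> c g c' g' Q)) \<and>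
    (\<forall>(I :: 'u set) Y e. Y \<in> Ob \<X> \<and>
       (\<forall>i \<in> I. Src \<X> (e i) = Y \<and>
          (\<exists>c g g' Q. tensor_comparison \<A> \<X> P c \<and> conical_pushout \<X> c g (e i) g' Q)) \<longrightarrow>
       (\<exists>\<alpha> Q. conical_wide_pushout \<X> I Y e \<alpha> Q))"

end

theory Submission
  imports Defs
begin

text \<open>
  Suppose first that \<open>P\<close> is order-solid. Discrete cocones are particular weighted cocones. To
  build \<open>W \<otimes> D\<close> in \<open>\<A>\<close>, extend the universal family \<open>\<kappa>\<^sup>u : PD \<rightarrow> W \<otimes> PD\<close>, seen as a weighted cocone
  over the one-point shape: a map \<open>W \<otimes> PD \<rightarrow> PB\<close> compatible with a given family \<open>D \<rightarrow> B\<close> exists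
  and is unique, and likewise for inequalities, so the conditions of the extension
  that mention \<open>\<X>\<close> hold by themselves and what remains is the universal property of \<open>W \<otimes> D\<close>
  (\<open>solid_imp_tensored\<close>).

  Conversely, let \<open>\<xi> : PD \<rightarrow> X\<close> be weighted by \<open>W\<close>. With tensor products in \<open>\<A>\<close>, a weighted cocone
  \<open>\<beta> : D \<rightarrow> B\<close> amounts to maps \<open>b\<^sub>i : Wi \<otimes> Di \<rightarrow> B\<close>, up to naturality. In \<open>\<X>\<close>, however, \<open>\<xi>\<close> only
  yields maps on \<open>Wi \<otimes> PDi\<close> and not on \<open>P (Wi \<otimes> Di)\<close>. So \<open>X\<close> is enlarged: push the comparison
  \<open>Wi \<otimes> PDi \<rightarrow> P (Wi \<otimes> Di)\<close> out along \<open>Wi \<otimes> PDi \<rightarrow> X\<close> for every \<open>i\<close>, and glue the results by a wide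
  pushout under \<open>X\<close>. The outcome \<open>Q\<close> carries a map from \<open>X\<close> and maps \<open>P (Wi \<otimes> Di) \<rightarrow> Q\<close>, universally
  (\<open>generalized_attachment\<close>), and this discrete cocone has an order-universal extension by
  assumption. Precomposing it with the tensor cocones in \<open>\<A>\<close> and with \<open>X \<rightarrow> Q\<close> gives the desired
  extension of \<open>\<xi>\<close>. Each order condition follows because tensor cocones and conical pushout
  cocones are order-epic.

  What is left is naturality in \<open>i\<close> of the resulting cocone. It holds after applying \<open>P\<close>, since
  \<open>\<xi>\<close> is natural, and \<open>P\<close> is faithful: if \<open>f \<noteq> g\<close> had the same image, the extension of the constant
  cocone at that image, indexed by the whole universe, would produce a different arrow for
  each subclass of the universe, against Cantor's theorem (\<open>discrete_extensions_imp_faithful\<close>).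

  If \<open>P\<close> preserves tensor products, the comparison morphisms are isomorphisms. These are stable
  under pushout, and pushouts and wide pushouts of isomorphisms exist in any ordered category.
\<close>

section \<open>Ordered categories\<close>

context ordered_category
begin

lemma leq_refl: "f \<in> Hom C a b \<Longrightarrow> f \<sqsubseteq> f"
  using hom_order[of a b] by (auto simp: partial_order_on_def preorder_on_def refl_on_def)

lemma leq_antisym: "\<lbrakk>f \<in> Hom C a b; g \<in> Hom C a b; f \<sqsubseteq> g; g \<sqsubseteq> f\<rbrakk> \<Longrightarrow> f = g"
  using hom_order[of a b] by (auto simp: partial_order_on_def antisym_def)

lemma src_Ob: "f \<in> Hom C a b \<Longrightarrow> a \<in> Ob C"
  and tgt_Ob: "f \<in> Hom C a b \<Longrightarrow> b \<in> Ob C"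
  using src_in_Ob tgt_in_Ob by (auto simp: Hom_def)

lemma ordered_category_op: "ordered_category (op_cat C)"
proof -
  have Hom: "Hom (op_cat C) a b = Hom C b a" for a b
    by (auto simp: Hom_def op_cat_def)
  show ?thesis
    by standard
      (unfold Hom, auto simp: op_cat_def src_in_Ob tgt_in_Ob comp_idt_right comp_idt_left
        hom_order idt_in_Hom
        intro: comp_in_Hom comp_mono_left comp_mono_right comp_assoc[symmetric])
qed

lemma ordered_functor_const:
  assumes "ordered_category S" "b \<in> Ob C"
  shows "ordered_functor S C (const_functor C b)"
proof -
  interpret S: ordered_category S by fact
  show ?thesis
    by unfold_locales
      (use assms(2) in \<open>auto simp: const_functor_def idt_in_Hom
        comp_idt_left[OF idt_in_Hom] intro: leq_refl[OF idt_in_Hom]\<close>)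
qed

lemma weighted_coconeD:
  assumes "weighted_cocone C S W D \<alpha> A"
  shows "A \<in> Ob C"
    and "\<And>i u. \<lbrakk>i \<in> Ob S; u \<in> Field (FOb W i)\<rbrakk> \<Longrightarrow> \<alpha> i u \<in> Hom C (FOb D i) A"
    and "\<And>i u v. \<lbrakk>i \<in> Ob S; (u, v) \<in> FOb W i\<rbrakk> \<Longrightarrow> \<alpha> i u \<sqsubseteq> \<alpha> i v"
    and "\<And>i j d v. \<lbrakk>i \<in> Ob S; j \<in> Ob S; d \<in> Hom S i j; v \<in> Field (FOb W j)\<rbrakk>
      \<Longrightarrow> \<alpha> j v \<cdot> FArr D d = \<alpha> i (papp (FArr W d) v)"
  using assms unfolding weighted_cocone_def by (auto split: prod.splits)

text \<open>
  Two arrows that agree on an order-epic cocone are below each other, hence equal by antisymmetry;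
  so uniqueness of \<open>t\<close> comes from the order condition.
\<close>

lemma weighted_colimit_iff:
  "weighted_colimit C S W D \<alpha> A \<longleftrightarrow>
    weighted_cocone C S W D \<alpha> A \<and>
    (\<forall>B \<beta>. weighted_cocone C S W D \<beta> B \<longrightarrow>
       (\<exists>t \<in> Hom C A B. \<forall>i \<in> Ob S. \<forall>u \<in> Field (FOb W i). t \<cdot> \<alpha> i u = \<beta> i u)) \<and>
    (\<forall>B. \<forall>r \<in> Hom C A B. \<forall>s \<in> Hom C A B.
       (\<forall>i \<in> Ob S. \<forall>u \<in> Field (FOb W i). r \<cdot> \<alpha> i u \<sqsubseteq> s \<cdot> \<alpha> i u) \<longrightarrow> r \<sqsubseteq> s)"
  (is "_ \<longleftrightarrow> ?cocone \<and> ?ex \<and> ?epic")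
proof
  assume "weighted_colimit C S W D \<alpha> A"
  then show "?cocone \<and> ?ex \<and> ?epic"
    unfolding weighted_colimit_def by blast
next
  assume *: "?cocone \<and> ?ex \<and> ?epic"
  have "r = s" if r: "r \<in> Hom C A B" and s: "s \<in> Hom C A B"
    and eq: "\<And>i u. \<lbrakk>i \<in> Ob S; u \<in> Field (FOb W i)\<rbrakk> \<Longrightarrow> r \<cdot> \<alpha> i u = s \<cdot> \<alpha> i u" for B r s
  proof -
    have "s \<cdot> \<alpha> i u \<sqsubseteq> s \<cdot> \<alpha> i u" if "i \<in> Ob S" "u \<in> Field (FOb W i)" for i u
      using * that by (intro leq_refl[OF comp_in_Hom[OF weighted_coconeD(2) s]]) auto
    then have "r \<sqsubseteq> s" "s \<sqsubseteq> r"
      using * r s eq by simp_all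
    then show ?thesis by (rule leq_antisym[OF r s])
  qed
  then show "weighted_colimit C S W D \<alpha> A"
    unfolding weighted_colimit_def using * by (smt (verit))
qed

end


section \<open>Cocones of discrete shape and tensor products\<close>

text \<open>
  A monotone map from \<open>W\<close> into the hom-set from \<open>D\<close> to \<open>B\<close>: the part of a weighted cocone that
  sits over a single object of its shape.
\<close>

definition monotone_family ::
    "('o, 'm) ocat \<Rightarrow> 'u rel \<Rightarrow> 'o \<Rightarrow> ('u \<Rightarrow> 'm) \<Rightarrow> 'o \<Rightarrow> bool"
  where "monotone_family C W D b B \<longleftrightarrow>
    (\<forall>u \<in> Field W. b u \<in> Hom C D B) \<and> (\<forall>(u, v) \<in> W. b u \<sqsubseteq>\<^bsub>C\<^esub> b v)"

lemma papp_Idt: "u \<in> Field w \<Longrightarrow> papp (Idt Pos w) u = u"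
  by (simp add: papp_def Pos_simps)

text \<open>
  Over a discrete shape naturality is vacuous, because functors and weights preserve the identities.
\<close>

lemma weighted_cocone_discrete:
  assumes "discrete_shape S" "ordered_functor S C D" "weight S W"
  shows "weighted_cocone C S W D \<beta> B \<longleftrightarrow>
    B \<in> Ob C \<and> (\<forall>i \<in> Ob S. monotone_family C (FOb W i) (FOb D i) (\<beta> i) B)"
proof -
  interpret D: ordered_functor S C D by fact
  interpret W: ordered_functor "op_cat S" Pos W by fact
  have "\<beta> j v \<cdot>\<^bsub>C\<^esub> FArr D d = \<beta> i (papp (FArr W d) v)"
    if "i \<in> Ob S" "d \<in> Hom S i j" "v \<in> Field (FOb W j)"
      and "\<forall>i \<in> Ob S. monotone_family C (FOb W i) (FOb D i) (\<beta> i) B" for i j d v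
  proof -
    have "d = Idt S i" "i = j"
      using assms(1) that(1,2) D.source.idt_in_Hom[of i]
      by (auto simp: discrete_shape_def Hom_def)
    moreover have "FArr W (Idt S i) = Idt Pos (FOb W i)"
      using W.FArr_idt[of i] that(1) by (simp add: op_cat_def)
    moreover have "\<beta> i v \<in> Hom C (FOb D i) B"
      using that \<open>i = j\<close> by (auto simp: monotone_family_def)
    ultimately show ?thesis
      using that D.FArr_idt[of i] by (simp add: papp_Idt D.target.comp_idt_right)
  qed
  then have "(\<forall>i \<in> Ob S. monotone_family C (FOb W i) (FOb D i) (\<beta> i) B) \<longrightarrow>
      (\<forall>i \<in> Ob S. \<forall>j \<in> Ob S. \<forall>d \<in> Hom S i j. \<forall>v \<in> Field (FOb W j).
         \<beta> j v \<cdot>\<^bsub>C\<^esub> FArr D d = \<beta> i (papp (FArr W d) v))"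
    by (intro impI ballI) blast
  then show ?thesis
    unfolding weighted_cocone_def monotone_family_def by (simp only: ball_conj_distrib) argo
qed

lemma discrete_terminal_shape: "discrete_shape terminal_shape"
  unfolding discrete_shape_def using ordered_category_terminal_shape
  by (auto simp: terminal_shape_def)

lemma weight_const:
  assumes "ordered_category S" "W \<in> Ob Pos"
  shows "weight S (const_functor Pos W)"
  using ordered_category.ordered_functor_const[OF ordered_category_Pos]
    ordered_category.ordered_category_op[OF assms(1)] assms(2) by blast

text \<open>
  The terminal shape is discrete, so the universal property of a tensor product can be stated
  without shapes and cocones.
\<close>

lemma (in ordered_category) is_tensor_iff:
  "is_tensor C W D l T \<longleftrightarrow>
    W \<in> Ob Pos \<and> D \<in> Ob C \<and> T \<in> Ob C \<and> monotone_family C W D l T \<and>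
    (\<forall>B b. monotone_family C W D b B \<and> B \<in> Ob C \<longrightarrow>
       (\<exists>t \<in> Hom C T B. \<forall>u \<in> Field W. t \<cdot> l u = b u)) \<and>
    (\<forall>B. \<forall>r \<in> Hom C T B. \<forall>s \<in> Hom C T B.
       (\<forall>u \<in> Field W. r \<cdot> l u \<sqsubseteq> s \<cdot> l u) \<longrightarrow> r \<sqsubseteq> s)"
proof (cases "W \<in> Ob Pos \<and> D \<in> Ob C")
  case True
  have cocone: "weighted_cocone C terminal_shape (const_functor Pos W) (const_functor C D) \<beta> B
      \<longleftrightarrow> B \<in> Ob C \<and> monotone_family C W D (\<beta> ()) B" for \<beta> B
    using weighted_cocone_discrete[OF discrete_terminal_shape
        ordered_functor_const[OF ordered_category_terminal_shape]
        weight_const[OF ordered_category_terminal_shape], of D W \<beta> B] True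
    by (simp add: const_functor_def terminal_shape_def)
  have ex: "(\<forall>B \<beta>. B \<in> Ob C \<and> monotone_family C W D (\<beta> ()) B \<longrightarrow> Q B (\<beta> ())) \<longleftrightarrow>
      (\<forall>B b. monotone_family C W D b B \<and> B \<in> Ob C \<longrightarrow> Q B b)" for Q
  proof (intro iffI allI impI)
    fix B b
    assume "\<forall>B \<beta>. B \<in> Ob C \<and> monotone_family C W D (\<beta> ()) B \<longrightarrow> Q B (\<beta> ())"
      "monotone_family C W D b B \<and> B \<in> Ob C"
    then show "Q B b" by (auto dest!: spec[of _ B] spec[of _ "\<lambda>_. b"])
  qed blast
  have simps: "Ob terminal_shape = UNIV" "FOb (const_functor Pos W) i = W" for i :: unit
    by (simp_all add: const_functor_def terminal_shape_def)
  have UNIV_unit: "(\<forall>i \<in> (UNIV :: unit set). R i) \<longleftrightarrow> R ()" for R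
    by (metis (full_types) UNIV_I unit.exhaust)
  show ?thesis
    unfolding is_tensor_def weighted_colimit_iff cocone simps UNIV_unit
      ex[of "\<lambda>B b. \<exists>t \<in> Hom C T B. \<forall>u \<in> Field W. t \<cdot> l u = b u"]
    by (simp only: conj_assoc)
qed (auto simp: is_tensor_def)


text \<open>
  Every element serves as its own identity arrow, so that each class over the universe gives a
  shape over the same universe.
\<close>

definition discrete_cat :: "'u set \<Rightarrow> ('u, 'u) ocat"
  where "discrete_cat I = \<lparr>Ob = I, Arr = I, Src = id, Tgt = id, Idt = id,
    Comp = (\<lambda>g f. g), Leq = (=)\<rparr>"

lemma discrete_shape_discrete_cat: "discrete_shape (discrete_cat I)"
proof -
  have "ordered_category (discrete_cat I)"
    by standard
      (auto simp: discrete_cat_def Hom_def partial_order_on_def preorder_on_def refl_on_def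
        trans_def antisym_def)
  then show ?thesis
    by (auto simp: discrete_shape_def discrete_cat_def)
qed

definition discrete_functor ::
    "('p, 'n) ocat \<Rightarrow> ('i \<Rightarrow> 'p) \<Rightarrow> ('i, 'i, 'p, 'n) ofunctor"
  where "discrete_functor C T = \<lparr>FOb = T, FArr = (\<lambda>i. Idt C (T i))\<rparr>"

lemma (in ordered_category) ordered_functor_discrete:
  assumes "\<And>i. i \<in> I \<Longrightarrow> T i \<in> Ob C"
  shows "ordered_functor (discrete_cat I) C (discrete_functor C T)"
proof -
  interpret S: ordered_category "discrete_cat I"
    using discrete_shape_discrete_cat by (auto simp: discrete_shape_def)
  have [simp]: "f \<in> Hom (discrete_cat I) a b \<longleftrightarrow> f \<in> I \<and> a = f \<and> b = f"
      "Ob (discrete_cat I) = I" "Idt (discrete_cat I) f = f" "Comp (discrete_cat I) f g = f"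
      "Leq (discrete_cat I) f g \<longleftrightarrow> f = g" for f g a b
    by (auto simp: Hom_def discrete_cat_def)
  show ?thesis
    by unfold_locales
      (use assms in \<open>auto simp: discrete_functor_def idt_in_Hom
        comp_idt_left[OF idt_in_Hom] intro: leq_refl[OF idt_in_Hom]\<close>)
qed


section \<open>Order-universal extensions\<close>

lemma ordered_functor_comp:
  assumes "ordered_functor B C G" "ordered_functor A B F"
  shows "ordered_functor A C (comp_functor G F)"
proof -
  interpret G: ordered_functor B C G by fact
  interpret F: ordered_functor A B F by fact
  show ?thesis
    by unfold_locales
      (auto simp: comp_functor_def G.FOb_in_Ob F.FOb_in_Ob F.FArr_idt G.FArr_idt F.FArr_comp
        F.FArr_mono
        intro: F.FArr_in_Hom G.FArr_in_Hom G.FArr_comp G.FArr_mono)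
qed

context ordered_functor
begin

text \<open>
  Uniqueness of \<open>t\<close> follows from the order condition by antisymmetry, as for weighted colimits.
\<close>

lemma order_universal_extension_iff:
  assumes "X \<in> Ob D"
  shows "order_universal_extension C D F S W E \<xi> X \<alpha> A q \<longleftrightarrow>
    weighted_cocone C S W E \<alpha> A \<and> q \<in> Hom D X (FOb F A) \<and>
    (\<forall>i \<in> Ob S. \<forall>u \<in> Field (FOb W i). q \<cdot>\<^bsub>D\<^esub> \<xi> i u = FArr F (\<alpha> i u)) \<and>
    (\<forall>B \<beta> f. weighted_cocone C S W E \<beta> B \<and> f \<in> Hom D X (FOb F B) \<and>
       (\<forall>i \<in> Ob S. \<forall>u \<in> Field (FOb W i). f \<cdot>\<^bsub>D\<^esub> \<xi> i u = FArr F (\<beta> i u)) \<longrightarrow>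
       (\<exists>t \<in> Hom C A B.
          (\<forall>i \<in> Ob S. \<forall>u \<in> Field (FOb W i). t \<cdot>\<^bsub>C\<^esub> \<alpha> i u = \<beta> i u) \<and>
          FArr F t \<cdot>\<^bsub>D\<^esub> q = f)) \<and>
    (\<forall>B. \<forall>r \<in> Hom C A B. \<forall>s \<in> Hom C A B.
       FArr F r \<cdot>\<^bsub>D\<^esub> q \<sqsubseteq>\<^bsub>D\<^esub> FArr F s \<cdot>\<^bsub>D\<^esub> q \<and>
       (\<forall>i \<in> Ob S. \<forall>u \<in> Field (FOb W i). r \<cdot>\<^bsub>C\<^esub> \<alpha> i u \<sqsubseteq>\<^bsub>C\<^esub> s \<cdot>\<^bsub>C\<^esub> \<alpha> i u)
       \<longrightarrow> r \<sqsubseteq>\<^bsub>C\<^esub> s)"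
  (is "_ \<longleftrightarrow> ?cocone \<and> ?q \<and> ?ext \<and> ?ex \<and> ?epic")
proof
  assume "order_universal_extension C D F S W E \<xi> X \<alpha> A q"
  then show "?cocone \<and> ?q \<and> ?ext \<and> ?ex \<and> ?epic"
    unfolding order_universal_extension_def by blast
next
  assume *: "?cocone \<and> ?q \<and> ?ext \<and> ?ex \<and> ?epic"
  have "r = s" if r: "r \<in> Hom C A B" and s: "s \<in> Hom C A B"
    and eq: "\<And>i u. \<lbrakk>i \<in> Ob S; u \<in> Field (FOb W i)\<rbrakk> \<Longrightarrow> r \<cdot>\<^bsub>C\<^esub> \<alpha> i u = s \<cdot>\<^bsub>C\<^esub> \<alpha> i u"
    and eq': "FArr F r \<cdot>\<^bsub>D\<^esub> q = FArr F s \<cdot>\<^bsub>D\<^esub> q" for B r s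
  proof -
    have "s \<cdot>\<^bsub>C\<^esub> \<alpha> i u \<sqsubseteq>\<^bsub>C\<^esub> s \<cdot>\<^bsub>C\<^esub> \<alpha> i u"
      if "i \<in> Ob S" "u \<in> Field (FOb W i)" for i u
      using * that
      by (intro source.leq_refl[OF source.comp_in_Hom[OF source.weighted_coconeD(2) s]]) auto
    moreover have "FArr F s \<cdot>\<^bsub>D\<^esub> q \<sqsubseteq>\<^bsub>D\<^esub> FArr F s \<cdot>\<^bsub>D\<^esub> q"
      using * target.leq_refl[OF target.comp_in_Hom[OF _ FArr_in_Hom[OF s]]] by blast
    ultimately have "r \<sqsubseteq>\<^bsub>C\<^esub> s" "s \<sqsubseteq>\<^bsub>C\<^esub> r"
      using * r s eq eq' by simp_all
    then show ?thesis by (rule source.leq_antisym[OF r s])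
  qed
  then show "order_universal_extension C D F S W E \<xi> X \<alpha> A q"
    unfolding order_universal_extension_def using * by (smt (verit))
qed

end

lemma one_poset_in_Pos:
  assumes "infinite (UNIV :: 'u set)"
  shows "(one_poset :: 'u rel) \<in> Ob Pos"
proof -
  have "{undefined :: 'u} \<prec> (UNIV :: 'u set)"
    using assms by (meson finite.emptyI finite_insert finite_lesspoll_infinite)
  then show ?thesis
    by (auto simp: Ob_Pos_iff one_poset_def small_def partial_order_on_def preorder_on_def
        refl_on_def trans_def antisym_def Field_def)
qed

lemma Field_one_poset: "Field one_poset = {undefined}"
  by (auto simp: one_poset_def Field_def)


section \<open>Conical wide pushouts\<close>

text \<open>
  The leg \<open>\<beta> None\<close> from the centre is kept as separate data, since for an empty family it is not
  determined by the other legs.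
\<close>

definition span_cocone ::
    "('o, 'm) ocat \<Rightarrow> 'i set \<Rightarrow> 'o \<Rightarrow> ('i \<Rightarrow> 'm) \<Rightarrow> ('i option \<Rightarrow> 'm) \<Rightarrow> 'o \<Rightarrow> bool"
  where "span_cocone C I Y e \<beta> B \<longleftrightarrow> \<beta> None \<in> Hom C Y B \<and>
    (\<forall>i \<in> I. \<beta> (Some i) \<in> Hom C (Tgt C (e i)) B \<and> \<beta> (Some i) \<cdot>\<^bsub>C\<^esub> e i = \<beta> None)"

lemma one_weight_simps:
  "FOb one_weight i = one_poset" "papp (FArr one_weight d) undefined = undefined"
  by (simp_all add: one_weight_def const_functor_def papp_Idt Field_one_poset)

text \<open>
  The constant weight has a single element at each object, so a weighted cocone is a plain
  family of arrows; naturality only concerns the arrows \<open>(None, Some i)\<close> of the span.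
\<close>

lemma conical_wide_pushout_iff:
  assumes "ordered_category C" "Y \<in> Ob C" "\<forall>i \<in> I. e i \<in> Arr C \<and> Src C (e i) = Y"
  shows "conical_wide_pushout C I Y e \<alpha> Q \<longleftrightarrow>
    span_cocone C I Y e \<alpha> Q \<and>
    (\<forall>B \<beta>. span_cocone C I Y e \<beta> B \<longrightarrow>
       (\<exists>t \<in> Hom C Q B. t \<cdot>\<^bsub>C\<^esub> \<alpha> None = \<beta> None \<and> (\<forall>i \<in> I. t \<cdot>\<^bsub>C\<^esub> \<alpha> (Some i) = \<beta> (Some i)))) \<and>
    (\<forall>B. \<forall>r \<in> Hom C Q B. \<forall>s \<in> Hom C Q B.
       r \<cdot>\<^bsub>C\<^esub> \<alpha> None \<sqsubseteq>\<^bsub>C\<^esub> s \<cdot>\<^bsub>C\<^esub> \<alpha> None \<and>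
       (\<forall>i \<in> I. r \<cdot>\<^bsub>C\<^esub> \<alpha> (Some i) \<sqsubseteq>\<^bsub>C\<^esub> s \<cdot>\<^bsub>C\<^esub> \<alpha> (Some i)) \<longrightarrow> r \<sqsubseteq>\<^bsub>C\<^esub> s)"
proof -
  interpret ordered_category C by fact
  interpret D: ordered_functor "span_shape I" C "span_diagram C Y e"
    by (rule ordered_functor_span_diagram[OF assms(1,2) bspec[OF assms(3)]])
  have Ob: "(\<forall>x \<in> Ob (span_shape I). R x) \<longleftrightarrow> R None \<and> (\<forall>i \<in> I. R (Some i))" for R
    by (auto simp: span_shape_def)
  have F: "FOb (span_diagram C Y e) None = Y"
    "FOb (span_diagram C Y e) (Some i) = Tgt C (e i)" for i
    by (simp_all add: span_diagram_def Let_def)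
  have Arr: "d \<in> Hom (span_shape I) x y \<longleftrightarrow>
      d = (x, y) \<and> x \<in> Ob (span_shape I) \<and> y \<in> Ob (span_shape I) \<and> (x = y \<or> x = None)"
    for d x y
    by (auto simp: span_shape_def Hom_def)
  have FArr: "FArr (span_diagram C Y e) (x, x) = Idt C (FOb (span_diagram C Y e) x)"
    "FArr (span_diagram C Y e) (None, Some i) = e i" for x i
    by (simp_all add: span_diagram_def Let_def)
  have cocone: "weighted_cocone C (span_shape I) one_weight (span_diagram C Y e) \<beta> B \<longleftrightarrow>
      span_cocone C I Y e (\<lambda>x. \<beta> x undefined) B" (is "?l \<longleftrightarrow> ?r") for \<beta> :: "_ \<Rightarrow> 'd \<Rightarrow> _" and B
  proof
    assume l: ?l
    have "\<beta> (Some i) undefined \<cdot>\<^bsub>C\<^esub> e i = \<beta> None undefined" if "i \<in> I" for i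
      using weighted_coconeD(4)[OF l, of None "Some i" "(None, Some i)" undefined] that
      by (simp add: Arr FArr one_weight_simps Field_one_poset) (simp add: span_shape_def)
    moreover have "\<beta> x undefined \<in> Hom C (FOb (span_diagram C Y e) x) B"
      if "x \<in> Ob (span_shape I)" for x
      using weighted_coconeD(2)[OF l that, of undefined]
      by (simp add: one_weight_simps Field_one_poset)
    from this[of None] this[of "Some _"] have "\<beta> None undefined \<in> Hom C Y B"
      "\<And>i. i \<in> I \<Longrightarrow> \<beta> (Some i) undefined \<in> Hom C (Tgt C (e i)) B"
      by (simp_all add: F span_shape_def)
    ultimately show ?r
      unfolding span_cocone_def by blast
  next
    assume r: ?r
    then have Hom: "\<beta> x undefined \<in> Hom C (FOb (span_diagram C Y e) x) B"
      if "x \<in> Ob (span_shape I)" for x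
      using that by (auto simp: span_cocone_def span_shape_def F)
    have "\<beta> y undefined \<cdot>\<^bsub>C\<^esub> FArr (span_diagram C Y e) d = \<beta> x undefined"
      if d: "d \<in> Hom (span_shape I) x y" for x y d
    proof (cases "x = y")
      case True
      then show ?thesis
        using d comp_idt_right[OF Hom[of x]] by (simp add: Arr FArr)
    next
      case False
      then have "d = (None, y)" "x = None" and y: "y \<in> Ob (span_shape I)" "y \<noteq> None"
        using d unfolding Arr by auto
      moreover from y obtain i where "y = Some i" "i \<in> I"
        by (auto simp: span_shape_def)
      ultimately show ?thesis
        using r by (simp add: FArr span_cocone_def)
    qed
    moreover have "B \<in> Ob C"
      using r tgt_Ob unfolding span_cocone_def by blast
    ultimately show ?l
      using Hom leq_refl[OF Hom] unfolding weighted_cocone_def one_weight_simps Field_one_poset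
      by (simp add: one_weight_simps(2)) (simp add: one_poset_def)
  qed
  have ex: "(\<forall>B. \<forall>\<beta> :: 'b option \<Rightarrow> 'a \<Rightarrow> 'a. R B (\<lambda>x. \<beta> x undefined)) \<longleftrightarrow> (\<forall>B \<beta>. R B \<beta>)" for R
  proof (intro iffI allI)
    fix B \<beta>
    assume "\<forall>B. \<forall>\<beta> :: 'b option \<Rightarrow> 'a \<Rightarrow> 'a. R B (\<lambda>x. \<beta> x undefined)"
    then show "R B \<beta>" by (auto dest!: spec[of _ B] spec[of _ "\<lambda>x _. \<beta> x"])
  qed blast
  show ?thesis
    unfolding conical_wide_pushout_def conical_colimit_def weighted_colimit_iff cocone Ob
      one_weight_simps Field_one_poset
    using ex[of "\<lambda>B \<beta>. span_cocone C I Y e \<beta> B \<longrightarrow>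
       (\<exists>t \<in> Hom C Q B. t \<cdot>\<^bsub>C\<^esub> \<alpha> None = \<beta> None \<and> (\<forall>i \<in> I. t \<cdot>\<^bsub>C\<^esub> \<alpha> (Some i) = \<beta> (Some i)))"]
    by simp
qed

text \<open>
  The usual form of a pushout square. The leg from the centre is the composite \<open>g' \<cdot> f\<close>, and an
  inequality on \<open>g'\<close> entails one on that composite.
\<close>

lemma conical_pushout_iff:
  assumes "ordered_category C" "f \<in> Hom C a b" "g \<in> Hom C a y"
  shows "conical_pushout C f g f' g' Q \<longleftrightarrow>
    g' \<in> Hom C b Q \<and> f' \<in> Hom C y Q \<and> g' \<cdot>\<^bsub>C\<^esub> f = f' \<cdot>\<^bsub>C\<^esub> g \<and>
    (\<forall>B. \<forall>x \<in> Hom C b B. \<forall>z \<in> Hom C y B. x \<cdot>\<^bsub>C\<^esub> f = z \<cdot>\<^bsub>C\<^esub> g \<longrightarrow>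
       (\<exists>t \<in> Hom C Q B. t \<cdot>\<^bsub>C\<^esub> g' = x \<and> t \<cdot>\<^bsub>C\<^esub> f' = z)) \<and>
    (\<forall>B. \<forall>r \<in> Hom C Q B. \<forall>s \<in> Hom C Q B.
       r \<cdot>\<^bsub>C\<^esub> g' \<sqsubseteq>\<^bsub>C\<^esub> s \<cdot>\<^bsub>C\<^esub> g' \<and> r \<cdot>\<^bsub>C\<^esub> f' \<sqsubseteq>\<^bsub>C\<^esub> s \<cdot>\<^bsub>C\<^esub> f' \<longrightarrow> r \<sqsubseteq>\<^bsub>C\<^esub> s)"
    (is "_ \<longleftrightarrow> ?rhs")
proof -
  interpret ordered_category C by fact
  have fg: "f \<in> Arr C" "g \<in> Arr C" "Src C f = a" "Src C g = a" "Tgt C f = b" "Tgt C g = y"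
    using assms by (auto simp: Hom_def)
  let ?e = "case_bool f g" and ?\<alpha> = "case_option (g' \<cdot>\<^bsub>C\<^esub> f) (case_bool g' f')"
  have all: "(\<forall>i \<in> UNIV. R i) \<longleftrightarrow> R True \<and> R False" for R :: "bool \<Rightarrow> bool"
    by (metis (full_types) UNIV_I)
  have cocone: "span_cocone C UNIV a ?e \<beta> B \<longleftrightarrow>
      \<beta> (Some True) \<in> Hom C b B \<and> \<beta> (Some False) \<in> Hom C y B \<and>
      \<beta> (Some True) \<cdot>\<^bsub>C\<^esub> f = \<beta> None \<and> \<beta> (Some False) \<cdot>\<^bsub>C\<^esub> g = \<beta> None" for \<beta> B
    using comp_in_Hom[OF assms(2), of "\<beta> (Some True)" B] unfolding span_cocone_def all
    by (auto simp: fg)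
  have "conical_pushout C f g f' g' Q \<longleftrightarrow> conical_wide_pushout C UNIV a ?e ?\<alpha> Q"
    by (simp add: conical_pushout_def fg)
  also have "\<dots> \<longleftrightarrow> ?rhs" (is "?lhs \<longleftrightarrow> _")
  proof -
    have iff: "?lhs \<longleftrightarrow>
      (g' \<in> Hom C b Q \<and> f' \<in> Hom C y Q \<and> f' \<cdot>\<^bsub>C\<^esub> g = g' \<cdot>\<^bsub>C\<^esub> f) \<and>
      (\<forall>B \<beta>. span_cocone C UNIV a ?e \<beta> B \<longrightarrow>
         (\<exists>t \<in> Hom C Q B. t \<cdot>\<^bsub>C\<^esub> (g' \<cdot>\<^bsub>C\<^esub> f) = \<beta> None \<and>
            t \<cdot>\<^bsub>C\<^esub> g' = \<beta> (Some True) \<and> t \<cdot>\<^bsub>C\<^esub> f' = \<beta> (Some False))) \<and>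
      (\<forall>B. \<forall>r \<in> Hom C Q B. \<forall>s \<in> Hom C Q B.
         r \<cdot>\<^bsub>C\<^esub> (g' \<cdot>\<^bsub>C\<^esub> f) \<sqsubseteq>\<^bsub>C\<^esub> s \<cdot>\<^bsub>C\<^esub> (g' \<cdot>\<^bsub>C\<^esub> f) \<and>
         r \<cdot>\<^bsub>C\<^esub> g' \<sqsubseteq>\<^bsub>C\<^esub> s \<cdot>\<^bsub>C\<^esub> g' \<and> r \<cdot>\<^bsub>C\<^esub> f' \<sqsubseteq>\<^bsub>C\<^esub> s \<cdot>\<^bsub>C\<^esub> f' \<longrightarrow> r \<sqsubseteq>\<^bsub>C\<^esub> s)"
      by (subst conical_wide_pushout_iff[OF assms(1) src_Ob[OF assms(2)]])
        (simp_all add: fg all_bool_eq cocone[of ?\<alpha>] split: bool.split)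
    show ?thesis
    proof
      assume ?lhs
      then have g': "g' \<in> Hom C b Q" and f': "f' \<in> Hom C y Q" "f' \<cdot>\<^bsub>C\<^esub> g = g' \<cdot>\<^bsub>C\<^esub> f"
        and ex: "\<And>B \<beta>. span_cocone C UNIV a ?e \<beta> B \<Longrightarrow>
         (\<exists>t \<in> Hom C Q B. t \<cdot>\<^bsub>C\<^esub> (g' \<cdot>\<^bsub>C\<^esub> f) = \<beta> None \<and>
            t \<cdot>\<^bsub>C\<^esub> g' = \<beta> (Some True) \<and> t \<cdot>\<^bsub>C\<^esub> f' = \<beta> (Some False))"
        and epic: "\<And>B r s. \<lbrakk>r \<in> Hom C Q B; s \<in> Hom C Q B;
         r \<cdot>\<^bsub>C\<^esub> (g' \<cdot>\<^bsub>C\<^esub> f) \<sqsubseteq>\<^bsub>C\<^esub> s \<cdot>\<^bsub>C\<^esub> (g' \<cdot>\<^bsub>C\<^esub> f);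
         r \<cdot>\<^bsub>C\<^esub> g' \<sqsubseteq>\<^bsub>C\<^esub> s \<cdot>\<^bsub>C\<^esub> g'; r \<cdot>\<^bsub>C\<^esub> f' \<sqsubseteq>\<^bsub>C\<^esub> s \<cdot>\<^bsub>C\<^esub> f'\<rbrakk> \<Longrightarrow> r \<sqsubseteq>\<^bsub>C\<^esub> s"
        unfolding iff by blast+
      have "\<exists>t \<in> Hom C Q B. t \<cdot>\<^bsub>C\<^esub> g' = x \<and> t \<cdot>\<^bsub>C\<^esub> f' = z"
        if "x \<in> Hom C b B" "z \<in> Hom C y B" "x \<cdot>\<^bsub>C\<^esub> f = z \<cdot>\<^bsub>C\<^esub> g" for B x z
        using ex[of "case_option (x \<cdot>\<^bsub>C\<^esub> f) (case_bool x z)" B] that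
        by (auto simp: cocone)
      moreover have "r \<sqsubseteq>\<^bsub>C\<^esub> s" if r: "r \<in> Hom C Q B" and s: "s \<in> Hom C Q B"
        and le: "r \<cdot>\<^bsub>C\<^esub> g' \<sqsubseteq>\<^bsub>C\<^esub> s \<cdot>\<^bsub>C\<^esub> g'" "r \<cdot>\<^bsub>C\<^esub> f' \<sqsubseteq>\<^bsub>C\<^esub> s \<cdot>\<^bsub>C\<^esub> f'" for B r s
        using comp_mono_right[OF assms(2) comp_in_Hom[OF g' r] comp_in_Hom[OF g' s]] le
        by (intro epic[OF r s])
          (simp_all add: comp_assoc[OF assms(2) g' r] comp_assoc[OF assms(2) g' s])
      ultimately show ?rhs using g' f' by auto
    next
      assume rhs: ?rhs
      then have g': "g' \<in> Hom C b Q" by blast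
      have "\<exists>t \<in> Hom C Q B. t \<cdot>\<^bsub>C\<^esub> (g' \<cdot>\<^bsub>C\<^esub> f) = \<beta> None \<and>
            t \<cdot>\<^bsub>C\<^esub> g' = \<beta> (Some True) \<and> t \<cdot>\<^bsub>C\<^esub> f' = \<beta> (Some False)"
        if \<beta>: "span_cocone C UNIV a ?e \<beta> B" for B \<beta>
      proof -
        from \<beta> rhs obtain t where
          "t \<in> Hom C Q B" "t \<cdot>\<^bsub>C\<^esub> g' = \<beta> (Some True)" "t \<cdot>\<^bsub>C\<^esub> f' = \<beta> (Some False)"
          unfolding cocone by metis
        then show ?thesis
          using \<beta> comp_assoc[OF assms(2) g'] unfolding cocone by fastforce
      qed
      then show ?lhs unfolding iff using rhs by auto
    qed
  qed
  finally show ?thesis .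
qed

section \<open>Attaching families of tensor products\<close>

text \<open>
  The object \<open>Q\<close> is obtained from \<open>X\<close> by universally extending each family \<open>\<xi> i : K\<^sub>i \<rightarrow> X\<close> along the
  family \<open>a i : K\<^sub>i \<rightarrow> L i\<close>: it carries \<open>e : X \<rightarrow> Q\<close> and \<open>h i : L i \<rightarrow> Q\<close> with
  \<open>h i \<cdot> a i u = e \<cdot> \<xi> i u\<close>, and is universal and order-epic with this property. Were the tensor
  products \<open>w i \<otimes> K\<^sub>i\<close> to exist, this would be the generalized pushout of the maps
  \<open>w i \<otimes> K\<^sub>i \<rightarrow> L i\<close> along the maps \<open>w i \<otimes> K\<^sub>i \<rightarrow> X\<close>; the point of the definition is that its
  universal property speaks of the original families only.
\<close>

definition attachment ::
    "('o, 'm) ocat \<Rightarrow> 'i set \<Rightarrow> ('i \<Rightarrow> 'u rel) \<Rightarrow> ('i \<Rightarrow> 'u \<Rightarrow> 'm) \<Rightarrow> ('i \<Rightarrow> 'o)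
      \<Rightarrow> ('i \<Rightarrow> 'u \<Rightarrow> 'm) \<Rightarrow> 'o \<Rightarrow> 'm \<Rightarrow> ('i \<Rightarrow> 'm) \<Rightarrow> 'o \<Rightarrow> bool"
  where "attachment C I w a L \<xi> X e h Q \<longleftrightarrow>
    e \<in> Hom C X Q \<and>
    (\<forall>i \<in> I. h i \<in> Hom C (L i) Q \<and> (\<forall>u \<in> Field (w i). h i \<cdot>\<^bsub>C\<^esub> a i u = e \<cdot>\<^bsub>C\<^esub> \<xi> i u)) \<and>
    (\<forall>Z. \<forall>f \<in> Hom C X Z. \<forall>y.
       (\<forall>i \<in> I. y i \<in> Hom C (L i) Z \<and> (\<forall>u \<in> Field (w i). y i \<cdot>\<^bsub>C\<^esub> a i u = f \<cdot>\<^bsub>C\<^esub> \<xi> i u)) \<longrightarrow>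
       (\<exists>t \<in> Hom C Q Z. t \<cdot>\<^bsub>C\<^esub> e = f \<and> (\<forall>i \<in> I. t \<cdot>\<^bsub>C\<^esub> h i = y i))) \<and>
    (\<forall>Z. \<forall>r \<in> Hom C Q Z. \<forall>s \<in> Hom C Q Z.
       r \<cdot>\<^bsub>C\<^esub> e \<sqsubseteq>\<^bsub>C\<^esub> s \<cdot>\<^bsub>C\<^esub> e \<and> (\<forall>i \<in> I. r \<cdot>\<^bsub>C\<^esub> h i \<sqsubseteq>\<^bsub>C\<^esub> s \<cdot>\<^bsub>C\<^esub> h i) \<longrightarrow> r \<sqsubseteq>\<^bsub>C\<^esub> s)"

context ordered_category
begin

lemma monotone_family_comp:
  assumes "monotone_family C w d b B" "t \<in> Hom C B B'"
  shows "monotone_family C w d (\<lambda>u. t \<cdot> b u) B'"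
proof -
  have "t \<cdot> b u \<sqsubseteq> t \<cdot> b v" if "(u, v) \<in> w" for u v
    using assms(1) that FieldI1[OF that] FieldI2[OF that]
      comp_mono_left[of "b u" d B "b v" t B', OF _ _ _ assms(2)]
    by (auto simp: monotone_family_def)
  then show ?thesis
    using assms by (auto simp: monotone_family_def intro: comp_in_Hom)
qed

lemma is_tensorD:
  assumes "is_tensor C w d l T"
  shows "w \<in> Ob Pos" "d \<in> Ob C" "T \<in> Ob C" "monotone_family C w d l T"
    and "u \<in> Field w \<Longrightarrow> l u \<in> Hom C d T"
  using assms unfolding is_tensor_iff monotone_family_def by blast+

lemma is_tensor_induced:
  assumes "is_tensor C w d l T" "monotone_family C w d b B" "B \<in> Ob C"
  shows "\<exists>t \<in> Hom C T B. \<forall>u \<in> Field w. t \<cdot> l u = b u"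
  using assms unfolding is_tensor_iff by blast

lemma is_tensor_epic:
  assumes "is_tensor C w d l T" "r \<in> Hom C T B" "s \<in> Hom C T B"
    and "\<And>u. u \<in> Field w \<Longrightarrow> r \<cdot> l u \<sqsubseteq> s \<cdot> l u"
  shows "r \<sqsubseteq> s"
  using assms unfolding is_tensor_iff by blast

lemma is_tensor_eqI:
  assumes T: "is_tensor C w d l T" and r: "r \<in> Hom C T B" and s: "s \<in> Hom C T B"
    and eq: "\<And>u. u \<in> Field w \<Longrightarrow> r \<cdot> l u = s \<cdot> l u"
  shows "r = s"
proof (rule leq_antisym[OF r s])
  have refl: "s \<cdot> l u \<sqsubseteq> s \<cdot> l u" if "u \<in> Field w" for u
    by (rule leq_refl[OF comp_in_Hom[OF is_tensorD(5)[OF T that] s]])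
  show "r \<sqsubseteq> s" by (rule is_tensor_epic[OF T r s]) (simp add: eq refl)
  show "s \<sqsubseteq> r" by (rule is_tensor_epic[OF T s r]) (simp add: eq refl)
qed

end

text \<open>
  Two maps out of \<open>K = w \<otimes> d\<close> are equal as soon as they agree on the tensor cocone, so commuting
  squares over \<open>c\<close> and \<open>g\<close> are the same as compatible families.
\<close>

lemma attachment_pushout:
  fixes C :: "('u, 'u) ocat" (structure)
  assumes C: "ordered_category C" and K: "is_tensor C w d k K" and c: "c \<in> Hom C K L"
    and ck: "\<And>u. u \<in> Field w \<Longrightarrow> c \<cdot> k u = a u"
    and g: "g \<in> Hom C K X" and gk: "\<And>u. u \<in> Field w \<Longrightarrow> g \<cdot> k u = \<xi> u"
    and po: "conical_pushout C c g e h Q"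
  shows "attachment C {i} (\<lambda>_. w) (\<lambda>_. a) (\<lambda>_. L) (\<lambda>_. \<xi>) X e (\<lambda>_. h) Q"
proof -
  interpret ordered_category C by fact
  note po = po[unfolded conical_pushout_iff[OF C c g]]
  have e: "e \<in> Hom C X Q" and h: "h \<in> Hom C L Q" and sq: "h \<cdot> c = e \<cdot> g"
    using po by blast+
  have "h \<cdot> a u = e \<cdot> \<xi> u" if "u \<in> Field w" for u
    using comp_assoc[OF is_tensorD(5)[OF K that] c h] comp_assoc[OF is_tensorD(5)[OF K that] g e]
    by (simp add: ck[OF that] gk[OF that] sq)
  moreover have "\<exists>t \<in> Hom C Q Z. t \<cdot> e = f \<and> t \<cdot> h = y"
    if f: "f \<in> Hom C X Z" and y: "y \<in> Hom C L Z"
      and eq: "\<forall>u \<in> Field w. y \<cdot> a u = f \<cdot> \<xi> u" for Z f y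
  proof -
    have "y \<cdot> c = f \<cdot> g"
    proof (rule is_tensor_eqI[OF K comp_in_Hom[OF c y] comp_in_Hom[OF g f]])
      fix u assume u: "u \<in> Field w"
      show "y \<cdot> c \<cdot> k u = f \<cdot> g \<cdot> k u"
        using comp_assoc[OF is_tensorD(5)[OF K u] c y] comp_assoc[OF is_tensorD(5)[OF K u] g f]
          eq u by (simp add: ck[OF u] gk[OF u])
    qed
    then show ?thesis using po f y by metis
  qed
  ultimately show ?thesis
    unfolding attachment_def using po e h by auto
qed

text \<open>
  Attachments of single families glue: a compatible map out of every \<open>R i\<close> is determined by its
  restrictions to \<open>X\<close> and to \<open>L i\<close>, and the restrictions to \<open>X\<close> coincide.
\<close>

lemma attachment_wide_pushout:
  fixes C :: "('u, 'u) ocat" (structure)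
  assumes C: "ordered_category C" and att: "\<And>i. i \<in> I \<Longrightarrow>
      attachment C {i} (\<lambda>_. w i) (\<lambda>_. a i) (\<lambda>_. L i) (\<lambda>_. \<xi> i) X (e i) (\<lambda>_. h i) (R i)"
    and "X \<in> Ob C"
    and \<xi>: "\<And>i u. \<lbrakk>i \<in> I; u \<in> Field (w i)\<rbrakk> \<Longrightarrow> \<xi> i u \<in> Hom C (d i) X"
    and a: "\<And>i u. \<lbrakk>i \<in> I; u \<in> Field (w i)\<rbrakk> \<Longrightarrow> a i u \<in> Hom C (d i) (L i)"
    and wide: "conical_wide_pushout C I X e \<alpha> Q"
  shows "attachment C I w a L \<xi> X (\<alpha> None) (\<lambda>i. \<alpha> (Some i) \<cdot> h i) Q"
proof -
  interpret ordered_category C by fact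
  have e: "e i \<in> Hom C X (R i)" and h: "h i \<in> Hom C (L i) (R i)"
    and hl: "\<And>u. u \<in> Field (w i) \<Longrightarrow> h i \<cdot> a i u = e i \<cdot> \<xi> i u"
    if "i \<in> I" for i
    using att[OF that] unfolding attachment_def by blast+
  have eA: "e i \<in> Arr C \<and> Src C (e i) = X" and Te: "Tgt C (e i) = R i" if "i \<in> I" for i
    using e[OF that] by (auto simp: Hom_def)
  have "\<forall>i \<in> I. e i \<in> Arr C \<and> Src C (e i) = X" using eA by blast
  note wide = wide[unfolded conical_wide_pushout_iff[OF C \<open>X \<in> Ob C\<close> this]]
  have p: "\<alpha> None \<in> Hom C X Q" using wide by (simp add: span_cocone_def)
  have n: "\<alpha> (Some i) \<in> Hom C (R i) Q" "\<alpha> (Some i) \<cdot> e i = \<alpha> None" if "i \<in> I" for i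
    using wide that by (auto simp: span_cocone_def Te)
  have m: "\<alpha> (Some i) \<cdot> h i \<in> Hom C (L i) Q" if "i \<in> I" for i
    using comp_in_Hom[OF h n(1)] that by blast
  have "\<alpha> (Some i) \<cdot> h i \<cdot> a i u = \<alpha> None \<cdot> \<xi> i u" if i: "i \<in> I" and u: "u \<in> Field (w i)" for i u
    using comp_assoc[OF a[OF i u] h[OF i] n(1)[OF i]] comp_assoc[OF \<xi>[OF i u] e[OF i] n(1)[OF i]]
      hl[OF i u] n(2)[OF i] by simp
  moreover have "\<exists>t \<in> Hom C Q Z. t \<cdot> \<alpha> None = f \<and> (\<forall>i \<in> I. t \<cdot> (\<alpha> (Some i) \<cdot> h i) = y i)"
    if f: "f \<in> Hom C X Z" and y: "\<And>i. i \<in> I \<Longrightarrow> y i \<in> Hom C (L i) Z"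
      and eq: "\<And>i u. \<lbrakk>i \<in> I; u \<in> Field (w i)\<rbrakk> \<Longrightarrow> y i \<cdot> a i u = f \<cdot> \<xi> i u" for Z f y
  proof -
    have "\<exists>x \<in> Hom C (R i) Z. x \<cdot> e i = f \<and> x \<cdot> h i = y i" if i: "i \<in> I" for i
    proof -
      have "\<forall>f \<in> Hom C X Z. \<forall>y. (\<forall>j \<in> {i}. y j \<in> Hom C (L i) Z \<and>
          (\<forall>u \<in> Field (w i). y j \<cdot> a i u = f \<cdot> \<xi> i u)) \<longrightarrow>
          (\<exists>t \<in> Hom C (R i) Z. t \<cdot> e i = f \<and> (\<forall>j \<in> {i}. t \<cdot> h i = y j))"
        using att[OF i] unfolding attachment_def by blast
      then show ?thesis using f y[OF i] eq[OF i] by simp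
    qed
    then obtain x where x: "\<And>i. i \<in> I \<Longrightarrow> x i \<in> Hom C (R i) Z"
      "\<And>i. i \<in> I \<Longrightarrow> x i \<cdot> e i = f" "\<And>i. i \<in> I \<Longrightarrow> x i \<cdot> h i = y i"
      by metis
    have "span_cocone C I X e (case_option f x) Z"
      using f x by (simp add: span_cocone_def Te)
    then obtain t where t: "t \<in> Hom C Q Z" "t \<cdot> \<alpha> None = f"
      "\<And>i. i \<in> I \<Longrightarrow> t \<cdot> \<alpha> (Some i) = x i"
      using wide by fastforce
    have "t \<cdot> (\<alpha> (Some i) \<cdot> h i) = y i" if "i \<in> I" for i
      using comp_assoc[OF h[OF that] n(1)[OF that] t(1)] t(3)[OF that] x(3)[OF that] by simp
    then show ?thesis using t by blast
  qed
  moreover have "r \<sqsubseteq> s"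
    if r: "r \<in> Hom C Q Z" and s: "s \<in> Hom C Q Z" and le: "r \<cdot> \<alpha> None \<sqsubseteq> s \<cdot> \<alpha> None"
      and leh: "\<And>i. i \<in> I \<Longrightarrow> r \<cdot> (\<alpha> (Some i) \<cdot> h i) \<sqsubseteq> s \<cdot> (\<alpha> (Some i) \<cdot> h i)" for Z r s
  proof -
    have "r \<cdot> \<alpha> (Some i) \<sqsubseteq> s \<cdot> \<alpha> (Some i)" if i: "i \<in> I" for i
    proof -
      have epic: "\<forall>r \<in> Hom C (R i) Z. \<forall>s \<in> Hom C (R i) Z.
          r \<cdot> e i \<sqsubseteq> s \<cdot> e i \<and> (\<forall>j \<in> {i}. r \<cdot> h i \<sqsubseteq> s \<cdot> h i) \<longrightarrow> r \<sqsubseteq> s"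
        using att[OF i] unfolding attachment_def by blast
      have "r \<cdot> \<alpha> (Some i) \<cdot> e i \<sqsubseteq> s \<cdot> \<alpha> (Some i) \<cdot> e i"
        using le by (simp add: n(2)[OF i] comp_assoc[OF e[OF i] n(1)[OF i] r]
            comp_assoc[OF e[OF i] n(1)[OF i] s])
      moreover have "r \<cdot> \<alpha> (Some i) \<cdot> h i \<sqsubseteq> s \<cdot> \<alpha> (Some i) \<cdot> h i"
        using leh[OF i] by (simp add: comp_assoc[OF h[OF i] n(1)[OF i] r]
            comp_assoc[OF h[OF i] n(1)[OF i] s])
      ultimately show ?thesis
        using epic comp_in_Hom[OF n(1)[OF i] r] comp_in_Hom[OF n(1)[OF i] s] by blast
    qed
    then show ?thesis using wide r s le by blast
  qed
  ultimately show ?thesis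
    unfolding attachment_def using p m by auto
qed


section \<open>Extensions of discrete cocones\<close>

locale ordered_functor_over_universe = ordered_functor \<A> \<X> P
  for \<A> \<X> :: "('u, 'u) ocat" and P +
  assumes infinite_universe: "infinite (UNIV :: 'u set)"
begin

lemma weight_one:
  assumes "ordered_category S"
  shows "weight S (one_weight :: ('i, 'j, 'u rel, 'u pmap) ofunctor)"
  unfolding one_weight_def
  by (rule weight_const[OF assms one_poset_in_Pos[OF infinite_universe]])

text \<open>
  The extension property for families \<open>m i : P (T i) \<rightarrow> X\<close> indexed by an arbitrary class, with the
  shape and the one-element weight removed.
\<close>

lemma discrete_extension:
  assumes ext: "admits_discrete_extensions \<A> \<X> P" and X: "X \<in> Ob \<X>"
    and T: "\<And>i. i \<in> (I :: 'u set) \<Longrightarrow> T i \<in> Ob \<A>"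
    and m: "\<And>i. i \<in> I \<Longrightarrow> m i \<in> Hom \<X> (FOb P (T i)) X"
  obtains \<alpha> A q where
    "A \<in> Ob \<A>" "q \<in> Hom \<X> X (FOb P A)"
    "\<And>i. i \<in> I \<Longrightarrow> \<alpha> i \<in> Hom \<A> (T i) A"
    "\<And>i. i \<in> I \<Longrightarrow> q \<cdot>\<^bsub>\<X>\<^esub> m i = FArr P (\<alpha> i)"
    "\<And>B \<beta> f. \<lbrakk>B \<in> Ob \<A>; \<forall>i \<in> I. \<beta> i \<in> Hom \<A> (T i) B; f \<in> Hom \<X> X (FOb P B);
        \<forall>i \<in> I. f \<cdot>\<^bsub>\<X>\<^esub> m i = FArr P (\<beta> i)\<rbrakk>
      \<Longrightarrow> \<exists>t \<in> Hom \<A> A B. (\<forall>i \<in> I. t \<cdot>\<^bsub>\<A>\<^esub> \<alpha> i = \<beta> i) \<and> FArr P t \<cdot>\<^bsub>\<X>\<^esub> q = f"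
    "\<And>B r s. \<lbrakk>r \<in> Hom \<A> A B; s \<in> Hom \<A> A B;
        FArr P r \<cdot>\<^bsub>\<X>\<^esub> q \<sqsubseteq>\<^bsub>\<X>\<^esub> FArr P s \<cdot>\<^bsub>\<X>\<^esub> q;
        \<forall>i \<in> I. r \<cdot>\<^bsub>\<A>\<^esub> \<alpha> i \<sqsubseteq>\<^bsub>\<A>\<^esub> s \<cdot>\<^bsub>\<A>\<^esub> \<alpha> i\<rbrakk> \<Longrightarrow> r \<sqsubseteq>\<^bsub>\<A>\<^esub> s"
proof -
  let ?S = "discrete_cat I" and ?D = "discrete_functor \<A> T"
  let ?one = "one_weight :: ('u, 'u, 'u rel, 'u pmap) ofunctor"
  have S: "discrete_shape ?S" by (rule discrete_shape_discrete_cat)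
  then have W: "weight ?S ?one" by (intro weight_one) (simp add: discrete_shape_def)
  have D: "ordered_functor ?S \<A> ?D" by (rule source.ordered_functor_discrete[OF T])
  have PD: "ordered_functor ?S \<X> (comp_functor P ?D)"
    by (rule ordered_functor_comp[OF ordered_functor_axioms D])
  have Ob: "Ob ?S = I" by (simp add: discrete_cat_def)
  have mf: "monotone_family C one_poset d b B \<longleftrightarrow> b undefined \<in> Hom C d B"
    if "ordered_category C" for C :: "('u, 'u) ocat" and d b B
    using ordered_category.leq_refl[OF that]
    by (auto simp: monotone_family_def Field_one_poset) (auto simp: one_poset_def)
  have coconeA: "weighted_cocone \<A> ?S ?one ?D \<beta> B \<longleftrightarrow>
      B \<in> Ob \<A> \<and> (\<forall>i \<in> I. \<beta> i undefined \<in> Hom \<A> (T i) B)" for \<beta> B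
    unfolding weighted_cocone_discrete[OF S D W] one_weight_simps
      mf[OF source.ordered_category_axioms] Ob
    by (simp add: discrete_functor_def)
  have "weighted_cocone \<X> ?S ?one (comp_functor P ?D) (\<lambda>i _. m i) X"
    unfolding weighted_cocone_discrete[OF S PD W] one_weight_simps
      mf[OF target.ordered_category_axioms] Ob
    using X m by (simp add: discrete_functor_def comp_functor_def)
  then obtain \<alpha> A q where
    "order_universal_extension \<A> \<X> P ?S ?one ?D (\<lambda>i _. m i) X \<alpha> A q"
    using ext S D unfolding admits_discrete_extensions_def by blast
  note uni = this[unfolded order_universal_extension_iff[OF X] coconeA one_weight_simps
      Field_one_poset Ob]
  show thesis
  proof (rule that[of A q "\<lambda>i. \<alpha> i undefined"])
    fix B \<beta> f
    assume "B \<in> Ob \<A>" "\<forall>i \<in> I. \<beta> i \<in> Hom \<A> (T i) B" "f \<in> Hom \<X> X (FOb P B)"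
      "\<forall>i \<in> I. f \<cdot>\<^bsub>\<X>\<^esub> m i = FArr P (\<beta> i)"
    then show "\<exists>t \<in> Hom \<A> A B. (\<forall>i \<in> I. t \<cdot>\<^bsub>\<A>\<^esub> \<alpha> i undefined = \<beta> i) \<and> FArr P t \<cdot>\<^bsub>\<X>\<^esub> q = f"
      using uni[THEN conjunct2, THEN conjunct2, THEN conjunct2, THEN conjunct1,
          THEN spec, of B, THEN spec, of "\<lambda>i _. \<beta> i", THEN spec, of f] by simp
  qed (use uni in blast)+
qed

text \<open>
  If \<open>f\<close> and \<open>g\<close> have the same image, then every choice of \<open>f\<close> or \<open>g\<close> at each index is a lift of the
  constant family with that image. Taking the whole universe as the index class, the extension
  turns subclasses of the universe injectively into arrows, which are elements of the universe.
\<close>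

lemma discrete_extensions_imp_faithful:
  assumes ext: "admits_discrete_extensions \<A> \<X> P"
    and f: "f \<in> Hom \<A> a b" and g: "g \<in> Hom \<A> a b" and eq: "FArr P f = FArr P g"
  shows "f = g"
proof (rule ccontr)
  assume "f \<noteq> g"
  have ab: "a \<in> Ob \<A>" "b \<in> Ob \<A>"
    using source.src_Ob[OF f] source.tgt_Ob[OF f] .
  have Pb: "FOb P b \<in> Ob \<X>" using ab FOb_in_Ob by blast
  have Pf: "FArr P f \<in> Hom \<X> (FOb P a) (FOb P b)" by (rule FArr_in_Hom[OF f])
  obtain \<alpha> A q where ex: "\<And>B \<beta> h. \<lbrakk>B \<in> Ob \<A>; \<forall>i \<in> (UNIV :: 'u set). \<beta> i \<in> Hom \<A> a B;
        h \<in> Hom \<X> (FOb P b) (FOb P B); \<forall>i \<in> UNIV. h \<cdot>\<^bsub>\<X>\<^esub> FArr P f = FArr P (\<beta> i)\<rbrakk>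
      \<Longrightarrow> \<exists>t \<in> Hom \<A> A B. (\<forall>i \<in> UNIV. t \<cdot>\<^bsub>\<A>\<^esub> \<alpha> i = \<beta> i) \<and> FArr P t \<cdot>\<^bsub>\<X>\<^esub> q = h"
    by (rule discrete_extension[OF ext Pb, of UNIV "\<lambda>_. a" "\<lambda>_. FArr P f"])
      (rule ab(1), rule Pf, rule that, assumption)
  \<comment> \<open>A subclass \<open>J\<close> encodes the choice of \<open>f\<close> on \<open>J\<close> and of \<open>g\<close> elsewhere.\<close>
  have "\<exists>t. \<forall>i. t \<cdot>\<^bsub>\<A>\<^esub> \<alpha> i = (if i \<in> J then f else g)" for J :: "'u set"
  proof -
    have "\<exists>t \<in> Hom \<A> A b. (\<forall>i \<in> UNIV. t \<cdot>\<^bsub>\<A>\<^esub> \<alpha> i = (if i \<in> J then f else g)) \<and>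
        FArr P t \<cdot>\<^bsub>\<X>\<^esub> q = Idt \<X> (FOb P b)"
      by (rule ex) (simp_all add: ab(2) f g eq target.idt_in_Hom[OF Pb]
          target.comp_idt_left[OF Pf, unfolded eq])
    then show ?thesis by blast
  qed
  then obtain t where t: "\<And>J i. t J \<cdot>\<^bsub>\<A>\<^esub> \<alpha> i = (if i \<in> J then f else g)"
    by metis
  have "inj t"
  proof (rule injI)
    fix J J' assume "t J = t J'"
    then have "i \<in> J \<longleftrightarrow> i \<in> J'" for i
      using t[of J i] t[of J' i] \<open>f \<noteq> g\<close> by (auto split: if_splits)
    then show "J = J'" by blast
  qed
  then have "inv t ` UNIV = Pow UNIV" by (simp add: inj_imp_surj_inv)
  then show False using Cantors_theorem by blast
qed


section \<open>Order-solid functors\<close>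

lemma monotone_family_image:
  assumes "monotone_family \<A> w d b B"
  shows "monotone_family \<X> w (FOb P d) (\<lambda>u. FArr P (b u)) (FOb P B)"
proof -
  have "FArr P (b u) \<sqsubseteq>\<^bsub>\<X>\<^esub> FArr P (b v)" if "(u, v) \<in> w" for u v
    using assms that FieldI1[OF that] FieldI2[OF that] FArr_mono[of "b u" d B "b v"]
    by (auto simp: monotone_family_def)
  then show ?thesis
    using assms by (auto simp: monotone_family_def intro: FArr_in_Hom)
qed

text \<open>
  Here the family \<open>\<xi>\<close> is attached along the image of a tensor cocone: the map \<open>c\<close> from
  \<open>w \<otimes> Pd\<close> to \<open>P (w \<otimes> d)\<close> is a comparison morphism, and \<open>g\<close> is the map \<open>w \<otimes> Pd \<rightarrow> X\<close> induced by \<open>\<xi>\<close>.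
\<close>

lemma comparison_attachment:
  assumes tensors: "has_tensors_of_image \<A> \<X> P"
    and pushouts: "has_conical_generalized_pushouts_of_comparisons \<A> \<X> P"
    and T: "is_tensor \<A> (w :: 'u rel) d l T"
    and \<xi>: "monotone_family \<X> w (FOb P d) \<xi> X" and X: "X \<in> Ob \<X>"
  obtains c g e h Q where "tensor_comparison \<A> \<X> P c" "conical_pushout \<X> c g e h Q"
    "attachment \<X> {i} (\<lambda>_. w) (\<lambda>_ u. FArr P (l u)) (\<lambda>_. FOb P T) (\<lambda>_. \<xi>) X e (\<lambda>_. h) Q"
proof -
  note TD = source.is_tensorD[OF T]
  obtain k K where K: "is_tensor \<X> w (FOb P d) k K"
    using tensors TD(1,2) unfolding has_tensors_of_image_def by blast
  have PT: "FOb P T \<in> Ob \<X>" using FOb_in_Ob[OF TD(3)] .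
  have Pl: "monotone_family \<X> w (FOb P d) (\<lambda>u. FArr P (l u)) (FOb P T)"
    by (rule monotone_family_image[OF TD(4)])
  obtain c where c: "c \<in> Hom \<X> K (FOb P T)"
    and ck: "\<And>u. u \<in> Field w \<Longrightarrow> c \<cdot>\<^bsub>\<X>\<^esub> k u = FArr P (l u)"
    using target.is_tensor_induced[OF K Pl PT] by blast
  obtain g where g: "g \<in> Hom \<X> K X" and gk: "\<And>u. u \<in> Field w \<Longrightarrow> g \<cdot>\<^bsub>\<X>\<^esub> k u = \<xi> u"
    using target.is_tensor_induced[OF K \<xi> X] by blast
  have comparison: "tensor_comparison \<A> \<X> P c"
    unfolding tensor_comparison_def using T K c ck by blast
  moreover obtain e h Q where po: "conical_pushout \<X> c g e h Q"
    using pushouts comparison c g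
    unfolding has_conical_generalized_pushouts_of_comparisons_def Hom_def by blast
  moreover note attachment_pushout[OF target.ordered_category_axioms K c ck g gk po, of i]
  ultimately show thesis by (rule that)
qed

text \<open>
  The pushouts of comparison morphisms that attach the individual families all start at \<open>X\<close>;
  their wide pushout attaches the whole, possibly large, collection.
\<close>

lemma generalized_attachment:
  assumes tensors: "has_tensors_of_image \<A> \<X> P"
    and pushouts: "has_conical_generalized_pushouts_of_comparisons \<A> \<X> P"
    and T: "\<And>i. i \<in> I \<Longrightarrow> is_tensor \<A> (w i :: 'u rel) (d i) (l i) (T i)"
    and \<xi>: "\<And>i. i \<in> I \<Longrightarrow> monotone_family \<X> (w i) (FOb P (d i)) (\<xi> i) X"
    and X: "X \<in> Ob \<X>"
  obtains p m Q where
    "attachment \<X> (I :: 'u set) w (\<lambda>i u. FArr P (l i u)) (\<lambda>i. FOb P (T i)) \<xi> X p m Q"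
proof -
  let ?a = "\<lambda>i u. FArr P (l i u)"
  have "\<exists>c g e h Q. tensor_comparison \<A> \<X> P c \<and> conical_pushout \<X> c g e h Q \<and>
      attachment \<X> {i} (\<lambda>_. w i) (\<lambda>_. ?a i) (\<lambda>_. FOb P (T i)) (\<lambda>_. \<xi> i) X e (\<lambda>_. h) Q"
    if "i \<in> I" for i
    by (rule comparison_attachment[OF tensors pushouts T[OF that] \<xi>[OF that] X, of i])
      (intro exI conjI, assumption+)
  then obtain c g e h R where
    po: "\<And>i. i \<in> I \<Longrightarrow> tensor_comparison \<A> \<X> P (c i)"
      "\<And>i. i \<in> I \<Longrightarrow> conical_pushout \<X> (c i) (g i) (e i) (h i) (R i)"
    and att: "\<And>i. i \<in> I \<Longrightarrow> attachment \<X> {i} (\<lambda>_. w i) (\<lambda>_. ?a i) (\<lambda>_. FOb P (T i))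
      (\<lambda>_. \<xi> i) X (e i) (\<lambda>_. h i) (R i)"
    by metis
  have "Src \<X> (e i) = X" if "i \<in> I" for i
    using att[OF that] unfolding attachment_def Hom_def by blast
  then obtain \<alpha> Q where wide: "conical_wide_pushout \<X> I X e \<alpha> Q"
    using pushouts po X unfolding has_conical_generalized_pushouts_of_comparisons_def by meson
  have "attachment \<X> I w ?a (\<lambda>i. FOb P (T i)) \<xi> X (\<alpha> None) (\<lambda>i. \<alpha> (Some i) \<cdot>\<^bsub>\<X>\<^esub> h i) Q"
  proof (rule attachment_wide_pushout[OF target.ordered_category_axioms att X _ _ wide])
    fix i u assume i: "i \<in> I" and u: "u \<in> Field (w i)"
    show "\<xi> i u \<in> Hom \<X> (FOb P (d i)) X"
      using \<xi>[OF i] u by (simp add: monotone_family_def)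
    show "FArr P (l i u) \<in> Hom \<X> (FOb P (d i)) (FOb P (T i))"
      by (rule FArr_in_Hom[OF source.is_tensorD(5)[OF T[OF i] u]])
  qed
  then show thesis by (rule that)
qed


text \<open>
  The extension of \<open>\<xi>\<close> is that of the discrete cocone \<open>m i : P (Wi \<otimes> Di) \<rightarrow> Q\<close> on the attachment \<open>Q\<close>,
  restricted along \<open>p : X \<rightarrow> Q\<close> and along the tensor cocones \<open>l i\<close>.
\<close>

lemma solid_if_tensored_and_discrete_extensions:
  assumes tensors: "has_tensors_of_image \<A> \<X> P"
    and pushouts: "has_conical_generalized_pushouts_of_comparisons \<A> \<X> P"
    and tensored: "tensored \<A>" and ext: "admits_discrete_extensions \<A> \<X> P"
  shows "order_solid \<A> \<X> P"
  unfolding order_solid_def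
proof (intro allI impI, elim conjE)
  fix S :: "('u, 'u) ocat" and W :: "('u, 'u, 'u rel, 'u pmap) ofunctor" and D \<xi> X
  assume D: "ordered_functor S \<A> D" and W: "weight S W"
    and \<xi>: "weighted_cocone \<X> S W (comp_functor P D) \<xi> X"
  interpret D: ordered_functor S \<A> D by fact
  interpret W: ordered_functor "op_cat S" Pos W by fact
  note \<xi>D = target.weighted_coconeD[OF \<xi>]
  let ?w = "FOb W" and ?d = "FOb D"
  have X: "X \<in> Ob \<X>" by (rule \<xi>D(1))
  have w: "?w i \<in> Ob Pos" and d: "?d i \<in> Ob \<A>" if "i \<in> Ob S" for i
    using W.FOb_in_Ob[of i] D.FOb_in_Ob[OF that] that by (simp_all add: op_cat_def)
  have "\<exists>l T. is_tensor \<A> (?w i) (?d i) l T" if "i \<in> Ob S" for i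
    using tensored w[OF that] d[OF that] unfolding tensored_def by blast
  then obtain l T where T: "\<And>i. i \<in> Ob S \<Longrightarrow> is_tensor \<A> (?w i) (?d i) (l i) (T i)"
    by metis
  have l: "l i u \<in> Hom \<A> (?d i) (T i)" if "i \<in> Ob S" "u \<in> Field (?w i)" for i u
    using source.is_tensorD(5)[OF T] that .
  have \<xi>mf: "monotone_family \<X> (?w i) (FOb P (?d i)) (\<xi> i) X" if "i \<in> Ob S" for i
    using \<xi>D(2,3)[OF that] by (auto simp: monotone_family_def comp_functor_def)
  have \<xi>_Hom: "\<xi> i u \<in> Hom \<X> (FOb P (?d i)) X" if "i \<in> Ob S" "u \<in> Field (?w i)" for i u
    using \<xi>mf[OF that(1)] that(2) by (simp add: monotone_family_def)
  obtain p m Q where att: "attachment \<X> (Ob S) ?w (\<lambda>i u. FArr P (l i u))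
      (\<lambda>i. FOb P (T i)) \<xi> X p m Q"
    by (rule generalized_attachment[where I = "Ob S" and w = ?w and d = ?d and l = l and T = T
          and \<xi> = \<xi> and X = X, OF tensors pushouts])
      (erule T, erule \<xi>mf, rule X, rule that)
  have p: "p \<in> Hom \<X> X Q"
    and m: "\<And>i. i \<in> Ob S \<Longrightarrow> m i \<in> Hom \<X> (FOb P (T i)) Q"
    and ml: "\<And>i u. \<lbrakk>i \<in> Ob S; u \<in> Field (?w i)\<rbrakk> \<Longrightarrow> m i \<cdot>\<^bsub>\<X>\<^esub> FArr P (l i u) = p \<cdot>\<^bsub>\<X>\<^esub> \<xi> i u"
    and Q_ex: "\<And>Z f y. \<lbrakk>f \<in> Hom \<X> X Z; \<forall>i \<in> Ob S. y i \<in> Hom \<X> (FOb P (T i)) Z \<and>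
         (\<forall>u \<in> Field (?w i). y i \<cdot>\<^bsub>\<X>\<^esub> FArr P (l i u) = f \<cdot>\<^bsub>\<X>\<^esub> \<xi> i u)\<rbrakk> \<Longrightarrow>
         \<exists>t \<in> Hom \<X> Q Z. t \<cdot>\<^bsub>\<X>\<^esub> p = f \<and> (\<forall>i \<in> Ob S. t \<cdot>\<^bsub>\<X>\<^esub> m i = y i)"
    and Q_epic: "\<And>Z r s. \<lbrakk>r \<in> Hom \<X> Q Z; s \<in> Hom \<X> Q Z; r \<cdot>\<^bsub>\<X>\<^esub> p \<sqsubseteq>\<^bsub>\<X>\<^esub> s \<cdot>\<^bsub>\<X>\<^esub> p;
         \<forall>i \<in> Ob S. r \<cdot>\<^bsub>\<X>\<^esub> m i \<sqsubseteq>\<^bsub>\<X>\<^esub> s \<cdot>\<^bsub>\<X>\<^esub> m i\<rbrakk> \<Longrightarrow> r \<sqsubseteq>\<^bsub>\<X>\<^esub> s"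
    using att unfolding attachment_def by simp_all
  have Q: "Q \<in> Ob \<X>" using target.tgt_Ob[OF p] .
  obtain \<alpha> A q where A: "A \<in> Ob \<A>" and q: "q \<in> Hom \<X> Q (FOb P A)"
    and \<alpha>: "\<And>i. i \<in> Ob S \<Longrightarrow> \<alpha> i \<in> Hom \<A> (T i) A"
    and qm: "\<And>i. i \<in> Ob S \<Longrightarrow> q \<cdot>\<^bsub>\<X>\<^esub> m i = FArr P (\<alpha> i)"
    and A_ex: "\<And>B \<beta> f. \<lbrakk>B \<in> Ob \<A>; \<forall>i \<in> Ob S. \<beta> i \<in> Hom \<A> (T i) B; f \<in> Hom \<X> Q (FOb P B);
        \<forall>i \<in> Ob S. f \<cdot>\<^bsub>\<X>\<^esub> m i = FArr P (\<beta> i)\<rbrakk>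
      \<Longrightarrow> \<exists>t \<in> Hom \<A> A B. (\<forall>i \<in> Ob S. t \<cdot>\<^bsub>\<A>\<^esub> \<alpha> i = \<beta> i) \<and> FArr P t \<cdot>\<^bsub>\<X>\<^esub> q = f"
    and A_epic: "\<And>B r s. \<lbrakk>r \<in> Hom \<A> A B; s \<in> Hom \<A> A B;
        FArr P r \<cdot>\<^bsub>\<X>\<^esub> q \<sqsubseteq>\<^bsub>\<X>\<^esub> FArr P s \<cdot>\<^bsub>\<X>\<^esub> q;
        \<forall>i \<in> Ob S. r \<cdot>\<^bsub>\<A>\<^esub> \<alpha> i \<sqsubseteq>\<^bsub>\<A>\<^esub> s \<cdot>\<^bsub>\<A>\<^esub> \<alpha> i\<rbrakk> \<Longrightarrow> r \<sqsubseteq>\<^bsub>\<A>\<^esub> s"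
    by (rule discrete_extension[where I = "Ob S" and T = T and m = m, OF ext Q])
      (erule source.is_tensorD(3)[OF T], erule m, rule that, assumption+)
  let ?\<alpha> = "\<lambda>i u. \<alpha> i \<cdot>\<^bsub>\<A>\<^esub> l i u" and ?q = "q \<cdot>\<^bsub>\<X>\<^esub> p"
  have \<alpha>l: "monotone_family \<A> (?w i) (?d i) (?\<alpha> i) A" if "i \<in> Ob S" for i
    by (rule source.monotone_family_comp[OF source.is_tensorD(4)[OF T[OF that]] \<alpha>[OF that]])
  have \<alpha>l_Hom: "?\<alpha> i u \<in> Hom \<A> (?d i) A" if "i \<in> Ob S" "u \<in> Field (?w i)" for i u
    by (rule source.comp_in_Hom[OF l[OF that] \<alpha>[OF that(1)]])
  have q\<xi>: "?q \<cdot>\<^bsub>\<X>\<^esub> \<xi> i u = FArr P (?\<alpha> i u)" if i: "i \<in> Ob S" and u: "u \<in> Field (?w i)" for i u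
    using target.comp_assoc[OF FArr_in_Hom[OF l[OF i u]] m[OF i] q]
      target.comp_assoc[OF \<xi>_Hom[OF i u] p q]
    by (simp add: ml[OF i u] qm[OF i] FArr_comp[OF l[OF i u] \<alpha>[OF i]])
  have cocone: "weighted_cocone \<A> S W D ?\<alpha> A"
    unfolding weighted_cocone_def
  proof (intro conjI ballI)
    fix i j \<delta> v
    assume i: "i \<in> Ob S" and j: "j \<in> Ob S" and \<delta>: "\<delta> \<in> Hom S i j" and v: "v \<in> Field (?w j)"
    let ?v = "papp (FArr W \<delta>) v"
    have "FArr W \<delta> \<in> Hom Pos (?w j) (?w i)"
      using \<delta> by (intro W.FArr_in_Hom) (simp add: Hom_def op_cat_def)
    then have v': "?v \<in> Field (?w i)"
      using v by (auto simp: Hom_Pos_iff papp_def)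
    \<comment> \<open>Attaching forgets the arrows of the shape, so naturality is only visible in \<open>\<X>\<close>; it
      is reflected by faithfulness.\<close>
    note D\<delta> = D.FArr_in_Hom[OF \<delta>]
    show "?\<alpha> j v \<cdot>\<^bsub>\<A>\<^esub> FArr D \<delta> = ?\<alpha> i ?v"
    proof (rule discrete_extensions_imp_faithful[OF ext _ \<alpha>l_Hom[OF i v']])
      show "?\<alpha> j v \<cdot>\<^bsub>\<A>\<^esub> FArr D \<delta> \<in> Hom \<A> (?d i) A"
        by (rule source.comp_in_Hom[OF D\<delta> \<alpha>l_Hom[OF j v]])
      have "FArr P (?\<alpha> j v \<cdot>\<^bsub>\<A>\<^esub> FArr D \<delta>) = ?q \<cdot>\<^bsub>\<X>\<^esub> \<xi> j v \<cdot>\<^bsub>\<X>\<^esub> FArr P (FArr D \<delta>)"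
        by (simp add: FArr_comp[OF D\<delta> \<alpha>l_Hom[OF j v]] q\<xi>[OF j v])
      also have "\<dots> = ?q \<cdot>\<^bsub>\<X>\<^esub> (\<xi> j v \<cdot>\<^bsub>\<X>\<^esub> FArr P (FArr D \<delta>))"
        by (rule target.comp_assoc[OF FArr_in_Hom[OF D\<delta>] \<xi>_Hom[OF j v]
              target.comp_in_Hom[OF p q]])
      also have "\<xi> j v \<cdot>\<^bsub>\<X>\<^esub> FArr P (FArr D \<delta>) = \<xi> i ?v"
        using \<xi>D(4)[OF i j \<delta> v] by (simp add: comp_functor_def)
      finally show "FArr P (?\<alpha> j v \<cdot>\<^bsub>\<A>\<^esub> FArr D \<delta>) = FArr P (?\<alpha> i ?v)"
        by (simp add: q\<xi>[OF i v'])
    qed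
  qed (use A \<alpha>l in \<open>auto simp: monotone_family_def\<close>)
  have "order_universal_extension \<A> \<X> P S W D \<xi> X ?\<alpha> A ?q"
    unfolding order_universal_extension_iff[OF X]
  proof (intro conjI allI impI ballI)
    fix B \<beta> f
    assume asm: "weighted_cocone \<A> S W D \<beta> B \<and> f \<in> Hom \<X> X (FOb P B) \<and>
      (\<forall>i \<in> Ob S. \<forall>u \<in> Field (?w i). f \<cdot>\<^bsub>\<X>\<^esub> \<xi> i u = FArr P (\<beta> i u))"
    then have f: "f \<in> Hom \<X> X (FOb P B)"
      and f\<xi>: "\<And>i u. \<lbrakk>i \<in> Ob S; u \<in> Field (?w i)\<rbrakk> \<Longrightarrow> f \<cdot>\<^bsub>\<X>\<^esub> \<xi> i u = FArr P (\<beta> i u)"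
      by blast+
    note \<beta>D = source.weighted_coconeD[OF conjunct1[OF asm]]
    have B: "B \<in> Ob \<A>" by (rule \<beta>D(1))
    have "\<exists>t \<in> Hom \<A> (T i) B. \<forall>u \<in> Field (?w i). t \<cdot>\<^bsub>\<A>\<^esub> l i u = \<beta> i u" if i: "i \<in> Ob S" for i
    proof -
      have "monotone_family \<A> (?w i) (?d i) (\<beta> i) B"
        using \<beta>D(2,3)[OF i] by (auto simp: monotone_family_def)
      from source.is_tensor_induced[OF T[OF i] this B] show ?thesis .
    qed
    then obtain b where b: "\<And>i. i \<in> Ob S \<Longrightarrow> b i \<in> Hom \<A> (T i) B"
      and bl: "\<And>i u. \<lbrakk>i \<in> Ob S; u \<in> Field (?w i)\<rbrakk> \<Longrightarrow> b i \<cdot>\<^bsub>\<A>\<^esub> l i u = \<beta> i u"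
      by metis
    have "FArr P (b i) \<cdot>\<^bsub>\<X>\<^esub> FArr P (l i u) = f \<cdot>\<^bsub>\<X>\<^esub> \<xi> i u"
      if i: "i \<in> Ob S" and u: "u \<in> Field (?w i)" for i u
      using FArr_comp[OF l[OF i u] b[OF i]] by (simp add: bl[OF i u] f\<xi>[OF i u])
    then obtain x where x: "x \<in> Hom \<X> Q (FOb P B)" "x \<cdot>\<^bsub>\<X>\<^esub> p = f"
      "\<forall>i \<in> Ob S. x \<cdot>\<^bsub>\<X>\<^esub> m i = FArr P (b i)"
      using Q_ex[OF f, of "\<lambda>i. FArr P (b i)"] FArr_in_Hom[OF b] by blast
    have "\<exists>t \<in> Hom \<A> A B. (\<forall>i \<in> Ob S. t \<cdot>\<^bsub>\<A>\<^esub> \<alpha> i = b i) \<and> FArr P t \<cdot>\<^bsub>\<X>\<^esub> q = x"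
      using b by (intro A_ex[OF B _ x(1,3)]) blast
    then obtain t where t: "t \<in> Hom \<A> A B" and t\<alpha>: "\<And>i. i \<in> Ob S \<Longrightarrow> t \<cdot>\<^bsub>\<A>\<^esub> \<alpha> i = b i"
      and tq: "FArr P t \<cdot>\<^bsub>\<X>\<^esub> q = x"
      by blast
    have "t \<cdot>\<^bsub>\<A>\<^esub> ?\<alpha> i u = \<beta> i u" if i: "i \<in> Ob S" and u: "u \<in> Field (?w i)" for i u
      using source.comp_assoc[OF l[OF i u] \<alpha>[OF i] t] by (simp add: t\<alpha>[OF i] bl[OF i u])
    moreover have "FArr P t \<cdot>\<^bsub>\<X>\<^esub> ?q = f"
      using target.comp_assoc[OF p q FArr_in_Hom[OF t]] by (simp add: tq x(2))
    ultimately show "\<exists>t \<in> Hom \<A> A B. (\<forall>i \<in> Ob S. \<forall>u \<in> Field (?w i). t \<cdot>\<^bsub>\<A>\<^esub> ?\<alpha> i u = \<beta> i u) \<and>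
        FArr P t \<cdot>\<^bsub>\<X>\<^esub> ?q = f"
      using t by blast
  next
    fix B r s
    assume r: "r \<in> Hom \<A> A B" and s: "s \<in> Hom \<A> A B"
      and le: "FArr P r \<cdot>\<^bsub>\<X>\<^esub> ?q \<sqsubseteq>\<^bsub>\<X>\<^esub> FArr P s \<cdot>\<^bsub>\<X>\<^esub> ?q \<and>
        (\<forall>i \<in> Ob S. \<forall>u \<in> Field (?w i). r \<cdot>\<^bsub>\<A>\<^esub> ?\<alpha> i u \<sqsubseteq>\<^bsub>\<A>\<^esub> s \<cdot>\<^bsub>\<A>\<^esub> ?\<alpha> i u)"
    note Pr = FArr_in_Hom[OF r] and Ps = FArr_in_Hom[OF s]
    have le\<alpha>: "r \<cdot>\<^bsub>\<A>\<^esub> \<alpha> i \<sqsubseteq>\<^bsub>\<A>\<^esub> s \<cdot>\<^bsub>\<A>\<^esub> \<alpha> i" if i: "i \<in> Ob S" for i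
    proof (rule source.is_tensor_epic[OF T[OF i] source.comp_in_Hom[OF \<alpha>[OF i] r]
          source.comp_in_Hom[OF \<alpha>[OF i] s]])
      fix u assume u: "u \<in> Field (?w i)"
      show "r \<cdot>\<^bsub>\<A>\<^esub> \<alpha> i \<cdot>\<^bsub>\<A>\<^esub> l i u \<sqsubseteq>\<^bsub>\<A>\<^esub> s \<cdot>\<^bsub>\<A>\<^esub> \<alpha> i \<cdot>\<^bsub>\<A>\<^esub> l i u"
        using le i u by (simp add: source.comp_assoc[OF l[OF i u] \<alpha>[OF i] r]
            source.comp_assoc[OF l[OF i u] \<alpha>[OF i] s])
    qed
    have "FArr P r \<cdot>\<^bsub>\<X>\<^esub> q \<sqsubseteq>\<^bsub>\<X>\<^esub> FArr P s \<cdot>\<^bsub>\<X>\<^esub> q"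
    proof (rule Q_epic[OF target.comp_in_Hom[OF q Pr] target.comp_in_Hom[OF q Ps]])
      show "FArr P r \<cdot>\<^bsub>\<X>\<^esub> q \<cdot>\<^bsub>\<X>\<^esub> p \<sqsubseteq>\<^bsub>\<X>\<^esub> FArr P s \<cdot>\<^bsub>\<X>\<^esub> q \<cdot>\<^bsub>\<X>\<^esub> p"
        using le by (simp add: target.comp_assoc[OF p q Pr] target.comp_assoc[OF p q Ps])
      show "\<forall>i \<in> Ob S. FArr P r \<cdot>\<^bsub>\<X>\<^esub> q \<cdot>\<^bsub>\<X>\<^esub> m i \<sqsubseteq>\<^bsub>\<X>\<^esub> FArr P s \<cdot>\<^bsub>\<X>\<^esub> q \<cdot>\<^bsub>\<X>\<^esub> m i"
      proof
        fix i assume i: "i \<in> Ob S"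
        show "FArr P r \<cdot>\<^bsub>\<X>\<^esub> q \<cdot>\<^bsub>\<X>\<^esub> m i \<sqsubseteq>\<^bsub>\<X>\<^esub> FArr P s \<cdot>\<^bsub>\<X>\<^esub> q \<cdot>\<^bsub>\<X>\<^esub> m i"
          using FArr_mono[OF source.comp_in_Hom[OF \<alpha>[OF i] r] source.comp_in_Hom[OF \<alpha>[OF i] s]
              le\<alpha>[OF i]]
          by (simp add: target.comp_assoc[OF m[OF i] q Pr] target.comp_assoc[OF m[OF i] q Ps]
              qm[OF i] FArr_comp[OF \<alpha>[OF i] r] FArr_comp[OF \<alpha>[OF i] s])
      qed
    qed
    then show "r \<sqsubseteq>\<^bsub>\<A>\<^esub> s"
      using le\<alpha> by (intro A_epic[OF r s]) blast+
  qed (use cocone q\<xi> target.comp_in_Hom[OF p q] in blast)+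
  then show "\<exists>\<alpha> A q. order_universal_extension \<A> \<X> P S W D \<xi> X \<alpha> A q"
    by blast
qed

text \<open>
  Extend the tensor cocone of \<open>w\<close> and \<open>Pd\<close> in \<open>\<X>\<close> over the one-point shape. The arrow \<open>f\<close> that the
  extension property asks for beside a family \<open>d \<rightarrow> B\<close> is the one induced on \<open>w \<otimes> Pd\<close>, and
  inequalities after \<open>q\<close> may be tested on the tensor cocone, where they follow from those
  in \<open>\<A>\<close>.
\<close>

lemma solid_imp_tensored:
  assumes solid: "order_solid \<A> \<X> P" and tensors: "has_tensors_of_image \<A> \<X> P"
  shows "tensored \<A>"
  unfolding tensored_def
proof (intro ballI)
  fix w :: "'u rel" and d assume w: "w \<in> Ob Pos" and d: "d \<in> Ob \<A>"
  obtain k K where K: "is_tensor \<X> w (FOb P d) k K"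
    using tensors w d unfolding has_tensors_of_image_def by blast
  let ?S = "discrete_cat {undefined :: 'u}" and ?D = "discrete_functor \<A> (\<lambda>_. d)"
  let ?W = "const_functor Pos w :: ('u, 'u, 'u rel, 'u pmap) ofunctor"
  have S: "discrete_shape ?S" by (rule discrete_shape_discrete_cat)
  then have W: "weight ?S ?W" using w by (intro weight_const) (simp_all add: discrete_shape_def)
  have D: "ordered_functor ?S \<A> ?D" by (rule source.ordered_functor_discrete[OF d])
  have PD: "ordered_functor ?S \<X> (comp_functor P ?D)"
    by (rule ordered_functor_comp[OF ordered_functor_axioms D])
  have simps: "Ob ?S = {undefined}" "\<And>i. FOb ?W i = w" "\<And>i. FOb ?D i = d"
    "\<And>i. FOb (comp_functor P ?D) i = FOb P d"
    by (simp_all add: discrete_cat_def const_functor_def discrete_functor_def comp_functor_def)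
  have KD: "K \<in> Ob \<X>" "monotone_family \<X> w (FOb P d) k K"
    using target.is_tensorD[OF K] by blast+
  have coconeA: "weighted_cocone \<A> ?S ?W ?D \<beta> B \<longleftrightarrow>
      B \<in> Ob \<A> \<and> monotone_family \<A> w d (\<beta> undefined) B" for \<beta> B
    unfolding weighted_cocone_discrete[OF S D W] simps by simp
  have "weighted_cocone \<X> ?S ?W (comp_functor P ?D) (\<lambda>_. k) K"
    unfolding weighted_cocone_discrete[OF S PD W] simps using KD by simp
  then obtain \<alpha> A q where
    "order_universal_extension \<A> \<X> P ?S ?W ?D (\<lambda>_. k) K \<alpha> A q"
    using solid D W unfolding order_solid_def by blast
  note uni = this[unfolded order_universal_extension_iff[OF KD(1)] coconeA simps]
  let ?l = "\<alpha> undefined"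
  have A: "A \<in> Ob \<A>" "monotone_family \<A> w d ?l A" and q: "q \<in> Hom \<X> K (FOb P A)"
    and qk: "\<And>u. u \<in> Field w \<Longrightarrow> q \<cdot>\<^bsub>\<X>\<^esub> k u = FArr P (?l u)"
    using uni by simp_all
  have k: "k u \<in> Hom \<X> (FOb P d) K" if "u \<in> Field w" for u
    by (rule target.is_tensorD(5)[OF K that])
  have l: "?l u \<in> Hom \<A> d A" if "u \<in> Field w" for u
    using A(2) that by (simp add: monotone_family_def)
  have "\<exists>t \<in> Hom \<A> A B. \<forall>u \<in> Field w. t \<cdot>\<^bsub>\<A>\<^esub> ?l u = b u"
    if b: "monotone_family \<A> w d b B" and B: "B \<in> Ob \<A>" for B b
  proof -
    obtain f where f: "f \<in> Hom \<X> K (FOb P B)"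
      "\<And>u. u \<in> Field w \<Longrightarrow> f \<cdot>\<^bsub>\<X>\<^esub> k u = FArr P (b u)"
      using target.is_tensor_induced[OF K monotone_family_image[OF b] FOb_in_Ob[OF B]] by blast
    show ?thesis
      using uni[THEN conjunct2, THEN conjunct2, THEN conjunct2, THEN conjunct1,
          THEN spec, of B, THEN spec, of "\<lambda>_. b", THEN spec, of f] b B f by auto
  qed
  moreover have "r \<sqsubseteq>\<^bsub>\<A>\<^esub> s" if r: "r \<in> Hom \<A> A B" and s: "s \<in> Hom \<A> A B"
    and le: "\<forall>u \<in> Field w. r \<cdot>\<^bsub>\<A>\<^esub> ?l u \<sqsubseteq>\<^bsub>\<A>\<^esub> s \<cdot>\<^bsub>\<A>\<^esub> ?l u" for B r s
  proof -
    note Pr = FArr_in_Hom[OF r] and Ps = FArr_in_Hom[OF s]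
    have "FArr P r \<cdot>\<^bsub>\<X>\<^esub> q \<sqsubseteq>\<^bsub>\<X>\<^esub> FArr P s \<cdot>\<^bsub>\<X>\<^esub> q"
    proof (rule target.is_tensor_epic[OF K target.comp_in_Hom[OF q Pr] target.comp_in_Hom[OF q Ps]])
      fix u assume u: "u \<in> Field w"
      show "FArr P r \<cdot>\<^bsub>\<X>\<^esub> q \<cdot>\<^bsub>\<X>\<^esub> k u \<sqsubseteq>\<^bsub>\<X>\<^esub> FArr P s \<cdot>\<^bsub>\<X>\<^esub> q \<cdot>\<^bsub>\<X>\<^esub> k u"
        using FArr_mono[OF source.comp_in_Hom[OF l[OF u] r] source.comp_in_Hom[OF l[OF u] s]] le u
        by (simp add: target.comp_assoc[OF k[OF u] q Pr] target.comp_assoc[OF k[OF u] q Ps]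
            qk[OF u] FArr_comp[OF l[OF u] r] FArr_comp[OF l[OF u] s])
    qed
    then show ?thesis
      using uni r s le by simp
  qed
  ultimately have "is_tensor \<A> w d ?l A"
    unfolding source.is_tensor_iff using w d A by blast
  then show "\<exists>l T. is_tensor \<A> w d l T" by blast
qed

lemma solid_imp_discrete_extensions:
  assumes "order_solid \<A> \<X> P"
  shows "admits_discrete_extensions \<A> \<X> P"
  unfolding admits_discrete_extensions_def
proof (intro allI impI, elim conjE)
  fix S :: "('u, 'u) ocat" and D and \<xi> :: "'u \<Rightarrow> 'u \<Rightarrow> 'u" and X
  assume "discrete_shape S" "ordered_functor S \<A> D"
    "weighted_cocone \<X> S (one_weight :: ('u, 'u, 'u rel, 'u pmap) ofunctor) (comp_functor P D) \<xi> X"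
  moreover from this have "weight S (one_weight :: ('u, 'u, 'u rel, 'u pmap) ofunctor)"
    by (intro weight_one) (simp add: discrete_shape_def)
  ultimately show "\<exists>\<alpha> A q. order_universal_extension \<A> \<X> P S one_weight D \<xi> X \<alpha> A q"
    using assms unfolding order_solid_def by blast
qed

end


section \<open>Functors preserving tensor products\<close>

context ordered_category
begin

definition inverse_arrows :: "'m \<Rightarrow> 'm \<Rightarrow> 'o \<Rightarrow> 'o \<Rightarrow> bool"
  where "inverse_arrows f g a b \<longleftrightarrow>
    f \<in> Hom C a b \<and> g \<in> Hom C b a \<and> g \<cdot> f = Idt C a \<and> f \<cdot> g = Idt C b"

lemma comp_inverse_cancel:
  assumes "inverse_arrows f g a b" "h \<in> Hom C a c"
  shows "h \<cdot> g \<cdot> f = h"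
  using assms comp_assoc[of f a b g a h c] comp_idt_right by (simp add: inverse_arrows_def)

lemma is_tensor_iso:
  assumes K: "is_tensor C w d k K" and L: "is_tensor C w d l L"
    and c: "c \<in> Hom C K L" and ck: "\<And>u. u \<in> Field w \<Longrightarrow> c \<cdot> k u = l u"
  shows "\<exists>c'. inverse_arrows c c' K L"
proof -
  note KD = is_tensorD[OF K] and LD = is_tensorD[OF L]
  obtain c' where c': "c' \<in> Hom C L K" and c'l: "\<And>u. u \<in> Field w \<Longrightarrow> c' \<cdot> l u = k u"
    using is_tensor_induced[OF L KD(4,3)] by blast
  have "c' \<cdot> c = Idt C K"
  proof (rule is_tensor_eqI[OF K comp_in_Hom[OF c c'] idt_in_Hom[OF KD(3)]])
    fix u assume u: "u \<in> Field w"
    show "c' \<cdot> c \<cdot> k u = Idt C K \<cdot> k u"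
      using comp_assoc[OF KD(5)[OF u] c c'] comp_idt_left[OF KD(5)[OF u]]
      by (simp add: ck[OF u] c'l[OF u])
  qed
  moreover have "c \<cdot> c' = Idt C L"
  proof (rule is_tensor_eqI[OF L comp_in_Hom[OF c' c] idt_in_Hom[OF LD(3)]])
    fix u assume u: "u \<in> Field w"
    show "c \<cdot> c' \<cdot> l u = Idt C L \<cdot> l u"
      using comp_assoc[OF LD(5)[OF u] c' c] comp_idt_left[OF LD(5)[OF u]]
      by (simp add: ck[OF u] c'l[OF u])
  qed
  ultimately show ?thesis
    using c c' unfolding inverse_arrows_def by blast
qed

end

lemma pushout_of_iso:
  fixes C :: "('u, 'u) ocat" (structure)
  assumes C: "ordered_category C" and f: "ordered_category.inverse_arrows C f f\<^sub>1 a b"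
    and g: "g \<in> Hom C a y"
  shows "conical_pushout C f g (Idt C y) (g \<cdot> f\<^sub>1) y"
proof -
  interpret ordered_category C by fact
  have fD: "f \<in> Hom C a b" "f\<^sub>1 \<in> Hom C b a" "f \<cdot> f\<^sub>1 = Idt C b"
    using f by (auto simp: inverse_arrows_def)
  have gf: "g \<cdot> f\<^sub>1 \<in> Hom C b y" by (rule comp_in_Hom[OF fD(2) g])
  have Idt: "Idt C y \<in> Hom C y y" by (rule idt_in_Hom[OF tgt_Ob[OF g]])
  have "g \<cdot> f\<^sub>1 \<cdot> f = Idt C y \<cdot> g"
    by (simp add: comp_inverse_cancel[OF f g] comp_idt_left[OF g])
  moreover have "\<exists>t \<in> Hom C y B. t \<cdot> (g \<cdot> f\<^sub>1) = x \<and> t \<cdot> Idt C y = z"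
    if x: "x \<in> Hom C b B" and z: "z \<in> Hom C y B" and eq: "x \<cdot> f = z \<cdot> g" for B x z
  proof -
    have "z \<cdot> (g \<cdot> f\<^sub>1) = x \<cdot> (f \<cdot> f\<^sub>1)"
      using comp_assoc[OF fD(2) g z] comp_assoc[OF fD(2,1) x] by (simp add: eq)
    also have "\<dots> = x" by (simp add: fD(3) comp_idt_right[OF x])
    finally show ?thesis using z comp_idt_right[OF z] by blast
  qed
  moreover have "r \<sqsubseteq> s" if "r \<in> Hom C y B" "s \<in> Hom C y B" "r \<cdot> Idt C y \<sqsubseteq> s \<cdot> Idt C y" for B r s
    using that by (simp add: comp_idt_right)
  ultimately show ?thesis
    unfolding conical_pushout_iff[OF C fD(1) g] using gf Idt by blast
qed

text \<open>
  The inverse of \<open>e\<close> is induced by \<open>Idt C y\<close> and \<open>g \<cdot> f\<^sub>1\<close>; that it is also a right inverse can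
  be tested on the pushout cocone.
\<close>

lemma iso_pushout_stable:
  fixes C :: "('u, 'u) ocat" (structure)
  assumes C: "ordered_category C" and f: "ordered_category.inverse_arrows C f f\<^sub>1 a b"
    and g: "g \<in> Hom C a y" and po: "conical_pushout C f g e h Q"
  shows "\<exists>e\<^sub>1. ordered_category.inverse_arrows C e e\<^sub>1 y Q"
proof -
  interpret ordered_category C by fact
  have fD: "f \<in> Hom C a b" "f\<^sub>1 \<in> Hom C b a" "f \<cdot> f\<^sub>1 = Idt C b"
    using f by (auto simp: inverse_arrows_def)
  note po = po[unfolded conical_pushout_iff[OF C fD(1) g]]
  have h: "h \<in> Hom C b Q" and e: "e \<in> Hom C y Q" and sq: "h \<cdot> f = e \<cdot> g"
    using po by blast+
  have gf: "g \<cdot> f\<^sub>1 \<in> Hom C b y" by (rule comp_in_Hom[OF fD(2) g])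
  have Idt: "Idt C y \<in> Hom C y y" "Idt C Q \<in> Hom C Q Q"
    using idt_in_Hom tgt_Ob[OF g] tgt_Ob[OF e] by blast+
  have "g \<cdot> f\<^sub>1 \<cdot> f = Idt C y \<cdot> g"
    by (simp add: comp_inverse_cancel[OF f g] comp_idt_left[OF g])
  then obtain t where t: "t \<in> Hom C Q y" "t \<cdot> h = g \<cdot> f\<^sub>1" "t \<cdot> e = Idt C y"
    using po gf Idt(1) by blast
  have et: "e \<cdot> t \<in> Hom C Q Q" by (rule comp_in_Hom[OF t(1) e])
  have "e \<cdot> (g \<cdot> f\<^sub>1) = h \<cdot> (f \<cdot> f\<^sub>1)"
    using comp_assoc[OF fD(2) g e] comp_assoc[OF fD(2,1) h] by (simp add: sq)
  then have eth: "e \<cdot> t \<cdot> h = Idt C Q \<cdot> h"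
    using comp_assoc[OF h t(1) e] by (simp add: t(2) fD(3) comp_idt_right[OF h] comp_idt_left[OF h])
  have ete: "e \<cdot> t \<cdot> e = Idt C Q \<cdot> e"
    using comp_assoc[OF e t(1) e] by (simp add: t(3) comp_idt_right[OF e] comp_idt_left[OF e])
  have refl: "Idt C Q \<cdot> h \<sqsubseteq> Idt C Q \<cdot> h" "Idt C Q \<cdot> e \<sqsubseteq> Idt C Q \<cdot> e"
    using leq_refl[OF comp_in_Hom[OF h Idt(2)]] leq_refl[OF comp_in_Hom[OF e Idt(2)]] .
  have epic: "r \<sqsubseteq> s" if "r \<in> Hom C Q Q" "s \<in> Hom C Q Q" "r \<cdot> h \<sqsubseteq> s \<cdot> h" "r \<cdot> e \<sqsubseteq> s \<cdot> e" for r s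
    using po that by blast
  have "e \<cdot> t = Idt C Q"
    by (rule leq_antisym[OF et Idt(2)]; rule epic; simp add: et Idt(2) eth ete refl)
  then show ?thesis
    using t e by (auto simp: inverse_arrows_def)
qed

text \<open>
  The vertex is \<open>Y\<close> itself with the inverses as legs, which covers the empty family, too.
\<close>

lemma wide_pushout_of_isos:
  fixes C :: "('u, 'u) ocat" (structure)
  assumes C: "ordered_category C" and Y: "Y \<in> Ob C"
    and iso: "\<And>i. i \<in> I \<Longrightarrow> ordered_category.inverse_arrows C (e i) (v i) Y (R i)"
  shows "conical_wide_pushout C I Y e (case_option (Idt C Y) v) Y"
proof -
  interpret ordered_category C by fact
  have e: "e i \<in> Hom C Y (R i)" and v: "v i \<in> Hom C (R i) Y" "v i \<cdot> e i = Idt C Y"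
    "e i \<cdot> v i = Idt C (R i)" if "i \<in> I" for i
    using iso[OF that] by (auto simp: inverse_arrows_def)
  have Te: "Tgt C (e i) = R i" if "i \<in> I" for i
    using e[OF that] by (simp add: Hom_def)
  have eA: "\<forall>i \<in> I. e i \<in> Arr C \<and> Src C (e i) = Y"
    using e by (auto simp: Hom_def)
  note Idt = idt_in_Hom[OF Y]
  have "\<exists>t \<in> Hom C Y B. t \<cdot> Idt C Y = \<beta> None \<and> (\<forall>i \<in> I. t \<cdot> v i = \<beta> (Some i))"
    if \<beta>: "span_cocone C I Y e \<beta> B" for B \<beta>
  proof -
    have b: "\<beta> None \<in> Hom C Y B" using \<beta> by (simp add: span_cocone_def)
    have "\<beta> None \<cdot> v i = \<beta> (Some i)" if i: "i \<in> I" for i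
    proof -
      have bi: "\<beta> (Some i) \<in> Hom C (R i) B" "\<beta> (Some i) \<cdot> e i = \<beta> None"
        using \<beta> i by (simp_all add: span_cocone_def Te)
      show ?thesis
        using comp_assoc[OF v(1)[OF i] e[OF i] bi(1)]
        by (simp add: bi(2) v(3)[OF i] comp_idt_right[OF bi(1)])
    qed
    then show ?thesis using b comp_idt_right[OF b] by blast
  qed
  moreover have "r \<sqsubseteq> s" if "r \<in> Hom C Y B" "s \<in> Hom C Y B" "r \<cdot> Idt C Y \<sqsubseteq> s \<cdot> Idt C Y" for B r s
    using that by (simp add: comp_idt_right)
  ultimately show ?thesis
    unfolding conical_wide_pushout_iff[OF C Y eA]
    using Idt v by (auto simp: span_cocone_def Te)
qed

context ordered_functor_over_universe
begin

lemma preserves_tensors_imp_has_tensors: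
  assumes "tensored \<A>" "preserves_tensors \<A> \<X> P"
  shows "has_tensors_of_image \<A> \<X> P"
  using assms unfolding tensored_def preserves_tensors_def has_tensors_of_image_def by meson

text \<open>
  Domain and codomain of a comparison morphism are then both tensor products of the same data.
\<close>

lemma preserves_tensors_imp_comparison_iso:
  assumes "preserves_tensors \<A> \<X> P" "tensor_comparison \<A> \<X> P c"
  shows "\<exists>c' K L. target.inverse_arrows c c' K L"
proof -
  obtain w :: "'u rel" and d l T k K where T: "is_tensor \<A> w d l T"
    and K: "is_tensor \<X> w (FOb P d) k K" and c: "c \<in> Hom \<X> K (FOb P T)"
    and ck: "\<And>u. u \<in> Field w \<Longrightarrow> c \<cdot>\<^bsub>\<X>\<^esub> k u = FArr P (l u)"
    using assms(2) unfolding tensor_comparison_def by blast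
  have "is_tensor \<X> w (FOb P d) (\<lambda>u. FArr P (l u)) (FOb P T)"
    using assms(1) T unfolding preserves_tensors_def by blast
  then show ?thesis
    using target.is_tensor_iso[OF K _ c ck] by blast
qed

lemma preserves_tensors_imp_has_pushouts:
  assumes pres: "preserves_tensors \<A> \<X> P"
  shows "has_conical_generalized_pushouts_of_comparisons \<A> \<X> P"
  unfolding has_conical_generalized_pushouts_of_comparisons_def
proof (intro conjI allI impI; elim conjE)
  fix c g
  assume c: "tensor_comparison \<A> \<X> P c" and g: "g \<in> Arr \<X>" "Src \<X> g = Src \<X> c"
  obtain c' K L where iso: "target.inverse_arrows c c' K L"
    using preserves_tensors_imp_comparison_iso[OF pres c] by blast
  then have "g \<in> Hom \<X> K (Tgt \<X> g)"
    using g by (simp add: target.inverse_arrows_def Hom_def)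
  from pushout_of_iso[OF target.ordered_category_axioms iso this]
  show "\<exists>c' g' Q. conical_pushout \<X> c g c' g' Q" by blast
next
  fix I :: "'u set" and Y e
  assume Y: "Y \<in> Ob \<X>" and legs: "\<forall>i \<in> I. Src \<X> (e i) = Y \<and>
    (\<exists>c g g' Q. tensor_comparison \<A> \<X> P c \<and> conical_pushout \<X> c g (e i) g' Q)"
  have "\<exists>v R. target.inverse_arrows (e i) v Y R" if "i \<in> I" for i
  proof -
    obtain c g g' Q where c: "tensor_comparison \<A> \<X> P c"
      and po: "conical_pushout \<X> c g (e i) g' Q" and Src: "Src \<X> (e i) = Y"
      using legs \<open>i \<in> I\<close> by blast
    obtain c' K L where iso: "target.inverse_arrows c c' K L"
      using preserves_tensors_imp_comparison_iso[OF pres c] by blast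
    then have "g \<in> Hom \<X> K (Tgt \<X> g)"
      using po by (simp add: target.inverse_arrows_def conical_pushout_def Hom_def)
    from iso_pushout_stable[OF target.ordered_category_axioms iso this po]
    obtain v where v: "target.inverse_arrows (e i) v (Tgt \<X> g) Q" by blast
    then have "Tgt \<X> g = Y"
      using Src by (simp add: target.inverse_arrows_def Hom_def)
    then show ?thesis using v by blast
  qed
  then obtain v R where v: "\<And>i. i \<in> I \<Longrightarrow> target.inverse_arrows (e i) (v i) Y (R i)"
    by metis
  have "conical_wide_pushout \<X> I Y e (case_option (Idt \<X> Y) v) Y"
    by (rule wide_pushout_of_isos[OF target.ordered_category_axioms Y v])
  then show "\<exists>\<alpha> Q. conical_wide_pushout \<X> I Y e \<alpha> Q" by blast
qed

end

theorem theorem5p11: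
  fixes \<A> \<X> :: "('u, 'u) ocat" and P :: "('u, 'u, 'u, 'u) ofunctor"
  assumes "infinite (UNIV :: 'u set)"
    and "ordered_category \<A>" and "ordered_category \<X>" and "ordered_functor \<A> \<X> P"
  shows "(has_tensors_of_image \<A> \<X> P \<and> has_conical_generalized_pushouts_of_comparisons \<A> \<X> P \<longrightarrow>
            (order_solid \<A> \<X> P \<longleftrightarrow> tensored \<A> \<and> admits_discrete_extensions \<A> \<X> P)) \<and>
         (tensored \<A> \<and> preserves_tensors \<A> \<X> P \<longrightarrow>
            has_tensors_of_image \<A> \<X> P \<and> has_conical_generalized_pushouts_of_comparisons \<A> \<X> P)"
proof -
  interpret ordered_functor \<A> \<X> P by fact
  interpret ordered_functor_over_universe \<A> \<X> P
    by unfold_locales fact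
  show ?thesis
    using solid_imp_tensored solid_imp_discrete_extensions
      solid_if_tensored_and_discrete_extensions preserves_tensors_imp_has_tensors
      preserves_tensors_imp_has_pushouts by blast
qed

end
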